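(* Let $S\subset \mathbb{I}^3$ be a bounded zero mean curvature graph over a simply connected Jordan domain $\Omega\subset\mathbb{C}\simeq xy\text{-plane}$. Suppose that $\partial S$ has an isotropic line segment $L$ on a boundary point $z_0\in\partial\Omega$ such that (1) $L$ connects two horizontal curves $\gamma_1$ and $\gamma_2$ on $\partial S$, and (2) the projections of $\gamma_1$ and $\gamma_2$ to the $xy$-plane form a regular (simple) analytic curve $\Gamma$ near $z_0$. Then $S$ can be extended real analytically across $L$ via the transformation $$\sigma(z,t)=(R_\Gamma(z),\,2m-t),$$ where $R_\Gamma$ is the reflection with respect to $\Gamma$ and $m$ is the height ($t$-coordinate) of the midpoint of $L$; that is, the extension is obtained by the analytic continuation across $\Gamma$ in the $xy$-plane and the reflection with respect to the height of the midpoint of $L$ in the $t$-direction.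
   Context: $\mathbb{I}^3$ is $\mathbb{R}^3\simeq\mathbb{C}\times\mathbb{R}$ with coordinates $(x,y,t)$, $z=x+iy$, and the degenerate metric $dx^2+dy^2$. A zero mean curvature graph over $\Omega$ is the graph $S=\{(z,\varphi(z)) : z\in\Omega\}$ of a harmonic function $\varphi:\Omega\to\mathbb{R}$; it is bounded if it is a bounded subset of $\mathbb{R}^3$. A Jordan domain is the interior of a Jordan curve. $\partial S=\overline{S}\setminus S$ in $\mathbb{R}^3$. An isotropic line segment is a (non-degenerate, closed) vertical segment, i.e. parallel to the $t$-axis. A horizontal curve is a curve contained in a plane $t=\mathrm{const}$. Boundary hypothesis: "$L$ is an isotropic line segment of $\partial S$ on $z_0$ connecting two horizontal curves $\gamma_1,\gamma_2$ of $\partial S$ whose projections form a regular simple analytic arc $\Gamma$ near $z_0$" means: there are an open neighbourhood $U$ of $z_0$ in $\mathbb{C}$ and reals $a\neq b$ such that $\Gamma:=\partial\Omega\cap U$ is a regular simple analytic arc containing $z_0$, $\Gamma\setminus\{z_0\}$ is the disjoint union of the two open subarcs $\Gamma_1,\Gamma_2$ on either side of $z_0$, and $\partial S\cap(U\times\mathbb{R})=\gamma_1\cup L\cup\gamma_2$, where $\gamma_1=\Gamma_1\times\{a\}$, $\gamma_2=\Gamma_2\times\{b\}$ and $L=\{z_0\}\times[\min(a,b),\max(a,b)]$. Regular simple analytic arc: a set $\Gamma=\gamma(I)\subset\mathbb{C}$ with $I\subset\mathbb{R}$ an open interval and $\gamma:I\to\mathbb{C}$ injective, real analytic, $\gamma'\neq0$.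 Writing $\gamma$ also for its holomorphic continuation to a neighbourhood of $I$ (conformal there), the reflection with respect to $\Gamma$ is $R_\Gamma:=\gamma\circ R\circ\gamma^{-1}$, defined near $\Gamma$, with $R$ complex conjugation; it does not depend on $\gamma$. Conformal parametrization: $X=(h,t):\mathbb{H}\to S$, where $\mathbb{H}$ is the upper half-plane, $h:\mathbb{H}\to\Omega$ is biholomorphic and $t=\varphi\circ h$. By Carathéodory's theorem $h$ extends to a homeomorphism of the closures ($\mathbb{H}$ closed up in the Riemann sphere), still denoted $h$. Let $\Pi(r,\theta)=re^{i\theta}$ on $\mathbb{R}\times(0,\pi)$. "$S$ can be extended real analytically across $L$ via $\sigma$" means: for a conformal parametrization $X$ with $h(0)=z_0$, there are an open set $V\subset\mathbb{R}\times(0,\pi)$ containing $\{0\}\times(0,\pi)$ and invariant under $\iota(r,\theta)=(-r,\pi-\theta)$, and a real analytic map $Y:V\to\mathbb{R}^3$, such that $Y=X\circ\Pi$ on $V\cap\{r>0\}$, $Y$ maps $\{0\}\times(0,\pi)$ onto $L$ minus its endpoints, and $Y(\iota(r,\theta))=\sigma(Y(r,\theta))$ for all $(r,\theta)\in V$ (in particular $\sigma$ is defined on $Y(V)$). *)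

theory Defs
  imports "HOL-Complex_Analysis.Complex_Analysis"
begin

text \<open>Three-space is \<^typ>\<open>complex \<times> real\<close>, with points written \<open>(z, t)\<close>.\<close>

text \<open>
  Real analyticity on an open set: local expansion into an (unconditionally, hence in finite
  dimension absolutely) convergent power series. The multi-indices are the functions
  \<open>k \<in> Basis \<rightarrow>\<^sub>E UNIV\<close>, i.e. one exponent for each coordinate of the domain.
\<close>
definition real_analytic_on :: "('a::euclidean_space \<Rightarrow> 'b::real_normed_vector) \<Rightarrow> 'a set \<Rightarrow> bool"
  where "real_analytic_on f S \<longleftrightarrow>
    (\<forall>p\<in>S. \<exists>e>0. \<exists>c :: ('a \<Rightarrow> nat) \<Rightarrow> 'b. \<forall>x\<in>ball p e.
      ((\<lambda>k. (\<Prod>b\<in>Basis. ((x - p) \<bullet> b) ^ k b) *\<^sub>R c k) has_sum f x) (Basis \<rightarrow>\<^sub>E UNIV))"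

text \<open>
  Harmonicity on an open set: \<open>u\<close> is twice continuously differentiable and
  \<open>u\<^sub>x\<^sub>x + u\<^sub>y\<^sub>y = 0\<close>.
\<close>
definition harmonic_on :: "(complex \<Rightarrow> real) \<Rightarrow> complex set \<Rightarrow> bool"
  where "harmonic_on u S \<longleftrightarrow>
    (\<exists>ux uy uxx uxy uyx uyy.
      (\<forall>z\<in>S. (u has_derivative (\<lambda>w. ux z * Re w + uy z * Im w)) (at z) \<and>
             (ux has_derivative (\<lambda>w. uxx z * Re w + uxy z * Im w)) (at z) \<and>
             (uy has_derivative (\<lambda>w. uyx z * Re w + uyy z * Im w)) (at z)) \<and>
      continuous_on S uxx \<and> continuous_on S uxy \<and> continuous_on S uyx \<and> continuous_on S uyy \<and>
      (\<forall>z\<in>S. uxx z + uyy z = 0))"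

definition Jordan_domain :: "complex set \<Rightarrow> bool"
  where "Jordan_domain \<Omega> \<longleftrightarrow>
    (\<exists>c. simple_path c \<and> pathfinish c = pathstart c \<and> \<Omega> = inside (path_image c))"

definition graph_over :: "complex set \<Rightarrow> (complex \<Rightarrow> real) \<Rightarrow> (complex \<times> real) set"
  where "graph_over \<Omega> \<phi> = {(z, \<phi> z) | z. z \<in> \<Omega>}"

definition surface_boundary :: "(complex \<times> real) set \<Rightarrow> (complex \<times> real) set"
  where "surface_boundary S = closure S - S"

definition isotropic_segment :: "complex \<Rightarrow> real \<Rightarrow> real \<Rightarrow> (complex \<times> real) set"
  where "isotropic_segment z\<^sub>0 a b = {z\<^sub>0} \<times> {min a b..max a b}"

definition regular_simple_analytic :: "(real \<Rightarrow> complex) \<Rightarrow> real set \<Rightarrow> bool"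
  where "regular_simple_analytic \<gamma> I \<longleftrightarrow>
    open I \<and> is_interval I \<and> I \<noteq> {} \<and> inj_on \<gamma> I \<and> real_analytic_on \<gamma> I \<and>
    (\<forall>s\<in>I. vector_derivative \<gamma> (at s) \<noteq> 0)"

text \<open>
  The reflection in an analytic arc \<open>\<Gamma>\<close> is canonical only as a germ along \<open>\<Gamma>\<close>, so it is
  a relation: \<open>R\<close>, restricted to the neighbourhood \<open>W\<close> of \<open>\<Gamma>\<close>, is
  \<open>G \<circ> cnj \<circ> G\<^sup>-\<^sup>1\<close> for an injective holomorphic continuation \<open>G\<close> of a regular
  parametrization of \<open>\<Gamma>\<close> to a conjugation-invariant neighbourhood of the parameter
  interval. The values of \<open>R\<close> outside \<open>W\<close> are irrelevant.
\<close>
definition reflection_near :: "complex set \<Rightarrow> complex set \<Rightarrow> (complex \<Rightarrow> complex) \<Rightarrow> bool"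
  where "reflection_near \<Gamma> W R \<longleftrightarrow>
    (\<exists>\<gamma> I N G. regular_simple_analytic \<gamma> I \<and> \<Gamma> = \<gamma> ` I \<and>
      open N \<and> complex_of_real ` I \<subseteq> N \<and> cnj ` N = N \<and>
      G holomorphic_on N \<and> inj_on G N \<and> (\<forall>s\<in>I. G (complex_of_real s) = \<gamma> s) \<and>
      W = G ` N \<and> (\<forall>w\<in>N. R (G w) = G (cnj w)))"

definition upper_half_plane :: "complex set"
  where "upper_half_plane = {w. Im w > 0}"

definition biholomorphic :: "(complex \<Rightarrow> complex) \<Rightarrow> complex set \<Rightarrow> complex set \<Rightarrow> bool"
  where "biholomorphic h A B \<longleftrightarrow>
    h holomorphic_on A \<and> bij_betw h A B \<and> inv_into A h holomorphic_on B"

text \<open>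
  A conformal parametrization \<open>X = (h, \<phi> \<circ> h)\<close> of the graph of \<open>\<phi>\<close>, normalized by
  \<open>h 0 = z\<^sub>0\<close>. Since \<open>0\<close> lies on the boundary of the half-plane, \<open>h 0\<close> is the value there
  of the continuous extension of \<open>h\<close> to the closure (which exists for every \<open>h\<close> by
  Caratheodory's theorem), that is, the limit of \<open>h\<close> at \<open>0\<close> from within the half-plane.
\<close>
definition conformal_parametrization_at ::
    "complex set \<Rightarrow> (complex \<Rightarrow> real) \<Rightarrow> complex \<Rightarrow> (complex \<Rightarrow> complex \<times> real) \<Rightarrow> bool"
  where "conformal_parametrization_at \<Omega> \<phi> z\<^sub>0 X \<longleftrightarrow>
    (\<exists>h. biholomorphic h upper_half_plane \<Omega> \<and> (h \<longlongrightarrow> z\<^sub>0) (at 0 within upper_half_plane) \<and>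
         X = (\<lambda>w. (h w, \<phi> (h w))))"

definition polar_swap :: "real \<times> real \<Rightarrow> real \<times> real"
  where "polar_swap = (\<lambda>(r, \<theta>). (- r, pi - \<theta>))"

text \<open>
  \<open>L\<^sub>0\<close> is the segment without its endpoints, \<open>D\<close> the domain of the partial
  transformation \<open>\<sigma>\<close>; \<open>rcis r \<theta>\<close> is \<open>r e\<^sup>i\<^sup>\<theta>\<close>.
\<close>
definition extends_across_via ::
    "(complex \<Rightarrow> complex \<times> real) \<Rightarrow> (complex \<times> real) set \<Rightarrow> (complex \<times> real) set \<Rightarrow>
     (complex \<times> real \<Rightarrow> complex \<times> real) \<Rightarrow> bool"
  where "extends_across_via X L\<^sub>0 D \<sigma> \<longleftrightarrow>
    (\<exists>V Y. open V \<and> V \<subseteq> UNIV \<times> {0<..<pi} \<and> {0} \<times> {0<..<pi} \<subseteq> V \<and> polar_swap ` V = V \<and>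
      real_analytic_on Y V \<and>
      (\<forall>r \<theta>. (r, \<theta>) \<in> V \<and> r > 0 \<longrightarrow> Y (r, \<theta>) = X (rcis r \<theta>)) \<and>
      Y ` ({0} \<times> {0<..<pi}) = L\<^sub>0 \<and>
      Y ` V \<subseteq> D \<and> (\<forall>p\<in>V. Y (polar_swap p) = \<sigma> (Y p)))"

text \<open>
  The surface extends across the segment over \<open>z\<^sub>0\<close> between the heights \<open>a\<close> and \<open>b\<close> via
  \<open>\<sigma> (z, t) = (R\<^sub>\<Gamma> z, 2 m - t)\<close>. Normalized conformal parametrizations and reflections near
  \<open>\<Gamma>\<close> are not unique, and the extension is required for all of them; their existence is
  part of the statement, so that it is not vacuous.
\<close>
definition extends_real_analytically_across ::
    "complex set \<Rightarrow> (complex \<Rightarrow> real) \<Rightarrow> complex \<Rightarrow> real \<Rightarrow> real \<Rightarrow> complex set \<Rightarrow> real \<Rightarrow> bool"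
  where "extends_real_analytically_across \<Omega> \<phi> z\<^sub>0 a b \<Gamma> m \<longleftrightarrow>
    (\<exists>X. conformal_parametrization_at \<Omega> \<phi> z\<^sub>0 X) \<and>
    (\<exists>W R. reflection_near \<Gamma> W R) \<and>
    (\<forall>X W R. conformal_parametrization_at \<Omega> \<phi> z\<^sub>0 X \<and> reflection_near \<Gamma> W R \<longrightarrow>
      extends_across_via X (isotropic_segment z\<^sub>0 a b - {(z\<^sub>0, a), (z\<^sub>0, b)})
        (W \<times> UNIV) (\<lambda>(z, t). (R z, 2 * m - t)))"

end

(*
  Let h be a conformal map of the upper half-plane onto Omega with h(0) = z_0. Continuing the inverse
  of h, read in a conformal chart that straightens Gamma, across the real axis by reflection in the
  unit circle shows that h itself continues holomorphically across 0 and intertwines complex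
  conjugation with the reflection in Gamma. The height phi o h is a bounded harmonic function with
  boundary values a and b on the two sides of 0; subtracting the harmonic function
  A + (B - A) theta / pi with the same boundary values leaves a bounded harmonic function vanishing on
  the real axis off 0, so 0 is a removable singularity and this remainder continues across 0 as an
  odd function. In polar coordinates the height is therefore affine in theta plus a function that is
  odd under conjugation, which is exactly the symmetry theta -> pi - theta, t -> 2 m - t.
*)
theory Submission
  imports Defs
begin

text \<open>Nothing is known about \<open>h\<close> at the boundary beyond its limit at 0, which is
  why its inverse is the map that gets reflected: a conformal map of \<Omega> onto the disc is
  proper, so in the chart its modulus tends to 1 at the real diameter, while its argument is not
  controlled at all. The reflection principle is therefore proved in a form that looks only at the
  modulus of the boundary values and tolerates one exceptional point. The same form serves for the
  height after exponentiation, where the exceptional point is the jump at 0.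

  Two parametrizations of the arc have to be kept apart. An arbitrary reflection comes with its own
  continuation \<open>G'\<close>, and the chart must be built from that one so that the reflection
  becomes conjugation; the heights \<open>a\<close> and \<open>b\<close> are distributed along
  \<gamma>. Comparing the two, and finding an injective continuation of \<gamma>, requires \<gamma>
  to be an embedding. Injectivity on an open interval alone does not give this, since an end of the
  arc could return to an interior point; the Jordan curve rules it out.\<close>

section \<open>Reflection of holomorphic functions of unimodular boundary values\<close>

text \<open>The primitives on the two half-discs are Lipschitz, so they reach the real diameter
  continuously even where \<open>g\<close> has no limit. The increment of their difference there is
  the limit of the integrated jump, which vanishes by dominated convergence; after subtracting
  constants they glue, and the derivative of the glued function extends \<open>g\<close>. A
  pointwise jump condition off one point suffices because only integrals are compared.\<close>

lemma holomorphic_extend_across_reals: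
  fixes g :: "complex \<Rightarrow> complex" and r M :: real
  assumes "0 < r"
    and holU: "g holomorphic_on ball 0 r \<inter> {z. 0 < Im z}"
    and holL: "g holomorphic_on ball 0 r \<inter> {z. Im z < 0}"
    and bnd: "\<And>z. \<lbrakk>z \<in> ball 0 r; Im z \<noteq> 0\<rbrakk> \<Longrightarrow> norm (g z) \<le> M"
    and jump: "\<And>x. \<lbrakk>x \<noteq> 0; \<bar>x\<bar> < r\<rbrakk> \<Longrightarrow>
                 ((\<lambda>y. g (Complex x y) - g (Complex x (- y))) \<longlongrightarrow> 0) (at_right 0)"
  obtains F where "F holomorphic_on ball 0 r" "\<And>z. \<lbrakk>z \<in> ball 0 r; Im z \<noteq> 0\<rbrakk> \<Longrightarrow> F z = g z"
proof -
  define D where "D = ball (0::complex) r"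
  define U where "U = D \<inter> {z. 0 < Im z}"
  define L where "L = D \<inter> {z. Im z < 0}"
  have op: "open D" "open U" "open L"
    by (auto simp: D_def U_def L_def open_halfspace_Im_gt open_halfspace_Im_lt)
  have cv: "convex U" "convex L"
    by (auto simp: D_def U_def L_def convex_halfspace_Im_gt convex_halfspace_Im_lt intro!: convex_Int)
  obtain P1 where P1: "\<And>z. z \<in> U \<Longrightarrow> (P1 has_field_derivative g z) (at z within U)"
    using holomorphic_convex_primitive'[OF cv(1) op(2)] holU unfolding U_def D_def by metis
  obtain P2 where P2: "\<And>z. z \<in> L \<Longrightarrow> (P2 has_field_derivative g z) (at z within L)"
    using holomorphic_convex_primitive'[OF cv(2) op(3)] holL unfolding L_def D_def by metis
  have "M \<ge> 0"
    using order_trans[OF norm_ge_zero bnd[of "\<i> * of_real (r/2)"]] \<open>0 < r\<close> by (auto simp: norm_mult)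
  have lip: "M-lipschitz_on U P1" "M-lipschitz_on L P2"
    using field_differentiable_bound[OF cv(1) P1, of M] field_differentiable_bound[OF cv(2) P2, of M]
      bnd \<open>M \<ge> 0\<close> by (auto intro!: lipschitz_onI simp: dist_norm U_def L_def D_def)
  obtain q1 where q1: "uniformly_continuous_on (closure U) q1" "\<And>x. x \<in> U \<Longrightarrow> P1 x = q1 x"
    using uniformly_continuous_on_extension_on_closure lipschitz_on_uniformly_continuous lip(1) by metis
  obtain q2 where q2: "uniformly_continuous_on (closure L) q2" "\<And>x. x \<in> L \<Longrightarrow> P2 x = q2 x"
    using uniformly_continuous_on_extension_on_closure lipschitz_on_uniformly_continuous lip(2) by metis
  have c1: "continuous_on (closure U) q1" and c2: "continuous_on (closure L) q2"
    using q1 q2 uniformly_continuous_imp_continuous by blast+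
  \<comment> \<open>Heights tending to 0. The offset 2 makes them smaller than r - |x| already for n
    = 0, so the horizontal segments from 0 to x at heights y and -y stay in the open disc.\<close>
  define y where "y x n = (r - \<bar>x\<bar>) / real (n + 2)" for x :: real and n
  have y_pos: "0 < y x n" if "\<bar>x\<bar> < r" for x n using that by (simp add: y_def)
  have y_lt: "y x n < r - \<bar>x\<bar>" if "\<bar>x\<bar> < r" for x n
    using that by (simp add: y_def divide_less_eq) 
  have y_lim: "y x \<longlonglongrightarrow> 0" for x
    unfolding y_def by real_asymp
  have in_UL: "Complex s (y x n) \<in> U" "Complex s (- y x n) \<in> L" if "\<bar>s\<bar> \<le> \<bar>x\<bar>" "\<bar>x\<bar> < r" for s x n
  proof -
    have "norm (Complex s (y x n)) < r" "norm (Complex s (- y x n)) < r"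
      using cmod_le[of "Complex s (y x n)"] cmod_le[of "Complex s (- y x n)"] y_pos[of x n] y_lt[of x n] that by auto
    then show "Complex s (y x n) \<in> U" "Complex s (- y x n) \<in> L"
      using y_pos[OF that(2)] by (auto simp: U_def L_def D_def)
  qed
  have lims: "(\<lambda>n. Complex s (y x n)) \<longlonglongrightarrow> complex_of_real s"
             "(\<lambda>n. Complex s (- y x n)) \<longlonglongrightarrow> complex_of_real s" for s x
    using tendsto_Complex[OF tendsto_const y_lim, of s x] 
      tendsto_Complex[OF tendsto_const tendsto_minus[OF y_lim], of s x]
    by (auto simp: complex_of_real_def)
  have cl: "complex_of_real s \<in> closure U" "complex_of_real s \<in> closure L" if "\<bar>s\<bar> < r" for s
    unfolding closure_sequential
    by (rule exI[of _ "\<lambda>n. Complex s (y s n)"] exI[of _ "\<lambda>n. Complex s (- y s n)"], intro conjI allI lims in_UL; use that in simp)+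
  have limq: "(\<lambda>n. P1 (Complex s (y x n))) \<longlonglongrightarrow> q1 s" "(\<lambda>n. P2 (Complex s (- y x n))) \<longlonglongrightarrow> q2 s"
    if "\<bar>s\<bar> \<le> \<bar>x\<bar>" "\<bar>x\<bar> < r" for s x
  proof -
    have "(\<lambda>n. q1 (Complex s (y x n))) \<longlonglongrightarrow> q1 s"
      by (rule continuous_on_tendsto_compose[OF c1 lims(1)])
        (use that cl[of s] in_UL[of s x] in \<open>auto intro!: always_eventually closure_subset[THEN subsetD]\<close>)
    then show "(\<lambda>n. P1 (Complex s (y x n))) \<longlonglongrightarrow> q1 s" using q1(2) in_UL that by simp
    have "(\<lambda>n. q2 (Complex s (- y x n))) \<longlonglongrightarrow> q2 s"
      by (rule continuous_on_tendsto_compose[OF c2 lims(2)])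
        (use that cl[of s] in_UL[of s x] in \<open>auto intro!: always_eventually closure_subset[THEN subsetD]\<close>)
    then show "(\<lambda>n. P2 (Complex s (- y x n))) \<longlonglongrightarrow> q2 s" using q2(2) in_UL that by simp
  qed
  have agree: "q1 x - q1 0 = q2 x - q2 0" if x: "\<bar>x\<bar> < r" for x :: real
  proof (cases "x = 0")
    case False
    \<comment> \<open>The derivative, along the segment from 0 to x, of \<open>P1\<close> at height
      y minus \<open>P2\<close> at height -y: x times the jump.\<close>
    define k where "k n t = of_real x * (g (Complex (t * x) (y x n)) - g (Complex (t * x) (- y x n)))" for n and t :: real
    have tx: "\<bar>t * x\<bar> \<le> \<bar>x\<bar>" if "t \<in> {0..1}" for t
      using that by (simp add: abs_mult mult_left_le_one_le)
    have int: "(k n has_integral (P1 (Complex x (y x n)) - P2 (Complex x (- y x n))) -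
                 (P1 (Complex 0 (y x n)) - P2 (Complex 0 (- y x n)))) {0..1}" for n
    proof -
      have "(k n has_integral (\<lambda>t. P1 (Complex (t * x) (y x n)) - P2 (Complex (t * x) (- y x n))) 1 -
               (\<lambda>t. P1 (Complex (t * x) (y x n)) - P2 (Complex (t * x) (- y x n))) 0) {0..1}"
      proof (rule fundamental_theorem_of_calculus)
        fix t :: real assume t: "t \<in> {0..1}"
        have d1: "(P1 has_field_derivative g (Complex (t * x) (y x n))) (at (Complex (t * x) (y x n)))"
          using P1[OF in_UL(1)[OF tx[OF t] x]] in_UL(1)[OF tx[OF t] x] op(2) at_within_open by metis
        have d2: "(P2 has_field_derivative g (Complex (t * x) (- y x n))) (at (Complex (t * x) (- y x n)))"
          using P2[OF in_UL(2)[OF tx[OF t] x]] in_UL(2)[OF tx[OF t] x] op(3) at_within_open by metis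
        have e: "((\<lambda>t. Complex (t * x) c) has_vector_derivative of_real x) (at t within {0..1})" for c
          unfolding has_vector_derivative_complex_iff by (auto intro!: derivative_eq_intros)
        show "((\<lambda>t. P1 (Complex (t * x) (y x n)) - P2 (Complex (t * x) (- y x n))) has_vector_derivative k n t)
                 (at t within {0..1})"
          unfolding k_def right_diff_distrib
          using field_vector_diff_chain_within[OF e has_field_derivative_at_within[OF d1]]
             field_vector_diff_chain_within[OF e has_field_derivative_at_within[OF d2]]
          by (intro has_vector_derivative_diff) (auto simp: o_def)
      qed simp
      then show ?thesis by simp
    qed
    \<comment> \<open>At t = 0 the segment is over the excluded point 0, where the jump need not
      tend to 0; one parameter does not affect the integral.\<close>
    define k' where "k' n t = (if t = 0 then 0 else k n t)" for n t
    have int': "(k' n has_integral (P1 (Complex x (y x n)) - P2 (Complex x (- y x n))) -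
                 (P1 (Complex 0 (y x n)) - P2 (Complex 0 (- y x n)))) {0..1}" for n
      by (rule has_integral_spike[OF _ _ int, of "{0}"]) (auto simp: k'_def)
    have "(\<lambda>n. integral {0..1} (k' n)) \<longlonglongrightarrow> integral {0..1} (\<lambda>t::real. 0)"
    proof (rule dominated_convergence(2))
      show "k' n integrable_on {0..1}" for n using int' by blast
      show "(\<lambda>t. \<bar>x\<bar> * (M + M)) integrable_on {0..1::real}" by (rule integrable_const_ivl)
      fix t :: real assume t: "t \<in> {0..1}"
      show "norm (k' n t) \<le> \<bar>x\<bar> * (M + M)" for n
      proof -
        have "norm (k n t) \<le> \<bar>x\<bar> * (M + M)"
          unfolding k_def norm_mult norm_of_real
          by (intro mult_left_mono order_trans[OF norm_triangle_ineq4] add_mono bnd)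
            (use in_UL[OF tx[OF t] x] y_pos[OF x, THEN less_imp_neq] in \<open>auto simp: U_def L_def D_def\<close>)
        then show ?thesis using \<open>M \<ge> 0\<close> by (auto simp: k'_def)
      qed
      show "(\<lambda>n. k' n t) \<longlonglongrightarrow> 0"
      proof (cases "t = 0")
        case False
        have "filterlim (y x) (at_right 0) sequentially"
          using y_lim y_pos[OF x] by (intro tendsto_imp_filterlim_at_right always_eventually) auto
        then have "(\<lambda>n. g (Complex (t * x) (y x n)) - g (Complex (t * x) (- y x n))) \<longlonglongrightarrow> 0"
          using filterlim_compose[OF jump[of "t * x"]] False \<open>x \<noteq> 0\<close> tx[OF t] x by auto
        from tendsto_mult_left[OF this, of "of_real x"] show ?thesis
          using False by (simp add: k'_def k_def)
      qed (simp add: k'_def)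
    qed
    moreover have "integral {0..1} (k' n) = (P1 (Complex x (y x n)) - P2 (Complex x (- y x n))) -
                 (P1 (Complex 0 (y x n)) - P2 (Complex 0 (- y x n)))" for n
      using int' by blast
    ultimately have "(\<lambda>n. (P1 (Complex x (y x n)) - P2 (Complex x (- y x n))) -
                 (P1 (Complex 0 (y x n)) - P2 (Complex 0 (- y x n)))) \<longlonglongrightarrow> 0" by simp
    moreover have "(\<lambda>n. (P1 (Complex x (y x n)) - P2 (Complex x (- y x n))) -
                 (P1 (Complex 0 (y x n)) - P2 (Complex 0 (- y x n)))) \<longlonglongrightarrow> (q1 x - q2 x) - (q1 0 - q2 0)"
      using limq[of x x] limq[of 0 x] x by (auto intro!: tendsto_diff)
    ultimately have "0 = (q1 x - q2 x) - (q1 0 - q2 0)" by (rule LIMSEQ_unique)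
    then show ?thesis by (simp add: algebra_simps)
  qed simp
  define q where "q z = (if Im z \<le> 0 then q2 z - q2 0 else q1 z - q1 0)" for z
  have reD: "z = complex_of_real (Re z) \<and> \<bar>Re z\<bar> < r" if "z \<in> D" "Im z = 0" for z
    using that abs_Re_le_cmod[of z] by (auto simp: D_def complex_eq_iff)
  have "continuous_on D q"
    unfolding q_def
  proof (rule continuous_on_cases_le)
    have "{t \<in> D. Im t \<le> 0} \<subseteq> closure L"
      using closure_subset[of L] cl(2) reD by (force simp: L_def order_le_less)
    then show "continuous_on {t \<in> D. Im t \<le> 0} (\<lambda>z. q2 z - q2 0)"
      by (intro continuous_intros continuous_on_subset[OF c2])
    have "{t \<in> D. 0 \<le> Im t} \<subseteq> closure U"
      using closure_subset[of U] cl(1) reD by (force simp: U_def order_le_less)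
    then show "continuous_on {t \<in> D. 0 \<le> Im t} (\<lambda>z. q1 z - q1 0)"
      by (intro continuous_intros continuous_on_subset[OF c1])
    show "\<And>t. t \<in> D \<Longrightarrow> Im t = 0 \<Longrightarrow> q2 t - q2 0 = q1 t - q1 0" using agree reD by metis
  qed (intro continuous_intros)
  moreover have dU: "(q has_field_derivative g z) (at z)" if "z \<in> U" for z
    by (rule has_field_derivative_transform_within_open[of "\<lambda>z. P1 z - q1 0" _ _ U])
      (use that op q1(2) P1[OF that] at_within_open[OF that op(2)] in \<open>auto intro!: derivative_eq_intros simp: q_def U_def\<close>)
  moreover have dL: "(q has_field_derivative g z) (at z)" if "z \<in> L" for z
    by (rule has_field_derivative_transform_within_open[of "\<lambda>z. P2 z - q2 0" _ _ L])
      (use that op q2(2) P2[OF that] at_within_open[OF that op(3)] in \<open>auto intro!: derivative_eq_intros simp: q_def L_def\<close>)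
  ultimately have "q holomorphic_on D"
    using holomorphic_on_paste_across_line[OF op(1), of \<i> q 0] op
    by (auto simp: inner_complex_def U_def L_def holomorphic_on_open)
  then have "deriv q holomorphic_on D" using holomorphic_deriv op by blast
  moreover have "deriv q z = g z" if "z \<in> D" "Im z \<noteq> 0" for z
    using that DERIV_imp_deriv dU dL by (fastforce simp: U_def L_def neq_iff)
  ultimately show ?thesis using that D_def by blast
qed

text \<open>For the reflected function 1 / cnj (f (cnj z)) the jump equals (|f|^2 - 1) / cnj f, so
  only the modulus of \<open>f\<close> has to converge. The lower bound \<open>m\<close> keeps the
  reflected function bounded and the jump quotient under control.\<close>

lemma unimodular_boundary_reflection:
  fixes f :: "complex \<Rightarrow> complex" and r m M :: real
  assumes "0 < r" "0 < m"
    and hol: "f holomorphic_on ball 0 r \<inter> {z. 0 < Im z}"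
    and bnd: "\<And>z. \<lbrakk>z \<in> ball 0 r; 0 < Im z\<rbrakk> \<Longrightarrow> m \<le> norm (f z) \<and> norm (f z) \<le> M"
    and bdry: "\<And>x. \<lbrakk>x \<noteq> 0; \<bar>x\<bar> < r\<rbrakk> \<Longrightarrow> ((\<lambda>y. norm (f (Complex x y))) \<longlongrightarrow> 1) (at_right 0)"
  obtains F where "F holomorphic_on ball 0 r"
    "\<And>z. \<lbrakk>z \<in> ball 0 r; 0 < Im z\<rbrakk> \<Longrightarrow> F z = f z"
    "\<And>z. z \<in> ball 0 r \<Longrightarrow> F (cnj z) * cnj (F z) = 1"
proof -
  define g where "g z = (if 0 < Im z then f z else inverse (cnj (f (cnj z))))" for z
  have nz: "f z \<noteq> 0" if "z \<in> ball 0 r" "0 < Im z" for z using bnd[OF that] \<open>0 < m\<close> by auto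
  have "cnj ` (ball 0 r \<inter> {z. Im z < 0}) = ball 0 r \<inter> {z. 0 < Im z}"
    by (auto simp: image_cnj_conv_vimage_cnj)
  then have hL: "(\<lambda>z. cnj (f (cnj z))) holomorphic_on ball 0 r \<inter> {z. Im z < 0}"
    using holomorphic_on_compose_cnj_cnj[of f "ball 0 r \<inter> {z. Im z < 0}"] hol
    by (simp add: o_def open_Int open_halfspace_Im_lt)
  obtain F where F: "F holomorphic_on ball 0 r" "\<And>z. \<lbrakk>z \<in> ball 0 r; Im z \<noteq> 0\<rbrakk> \<Longrightarrow> F z = g z"
  proof (rule holomorphic_extend_across_reals[of r g "max M (inverse m)"])
    show "g holomorphic_on ball 0 r \<inter> {z. 0 < Im z}"
      using hol by (rule holomorphic_transform) (auto simp: g_def)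
    show "g holomorphic_on ball 0 r \<inter> {z. Im z < 0}"
      by (rule holomorphic_transform[OF holomorphic_on_inverse[OF hL]]) (use nz in \<open>auto simp: g_def\<close>)
    show "norm (g z) \<le> max M (inverse m)" if "z \<in> ball 0 r" "Im z \<noteq> 0" for z
      using that bnd[of z] bnd[of "cnj z"] \<open>0 < m\<close>
      by (auto simp: g_def norm_inverse intro!: le_max_iff_disj[THEN iffD2] le_imp_inverse_le)
    fix x :: real assume x: "x \<noteq> 0" "\<bar>x\<bar> < r"
    have ev: "\<forall>\<^sub>F y in at_right 0. 0 < y \<and> Complex x y \<in> ball 0 r"
    proof (rule eventually_at_rightI[of 0 "r - \<bar>x\<bar>"])
      fix y assume "y \<in> {0<..<r - \<bar>x\<bar>}"
      then show "0 < y \<and> Complex x y \<in> ball 0 r" using cmod_le[of "Complex x y"] by auto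
    qed (use x in simp)
    show "((\<lambda>y. g (Complex x y) - g (Complex x (- y))) \<longlongrightarrow> 0) (at_right 0)"
    proof (rule Lim_null_comparison)
      have "((\<lambda>y. \<bar>(norm (f (Complex x y)))\<^sup>2 - 1\<bar> / m) \<longlongrightarrow> \<bar>1\<^sup>2 - 1\<bar> / m) (at_right 0)"
        by (intro tendsto_intros bdry x) (use \<open>0 < m\<close> in auto)
      then show "((\<lambda>y. \<bar>(norm (f (Complex x y)))\<^sup>2 - 1\<bar> / m) \<longlongrightarrow> 0) (at_right 0)" by simp
      show "\<forall>\<^sub>F y in at_right 0. norm (g (Complex x y) - g (Complex x (- y))) \<le> \<bar>(norm (f (Complex x y)))\<^sup>2 - 1\<bar> / m"
        using ev
      proof eventually_elim
        case (elim y)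
        define v where "v = f (Complex x y)"
        have v: "m \<le> norm v" "v \<noteq> 0" using elim bnd nz by (auto simp: v_def)
        have "g (Complex x y) - g (Complex x (- y)) = v - inverse (cnj v)"
          using elim by (auto simp: g_def v_def complex_cnj)
        also have "\<dots> = of_real ((norm v)\<^sup>2 - 1) / cnj v"
          using v by (simp add: field_simps complex_mult_cnj cmod_power2)
        also have "norm \<dots> = \<bar>(norm v)\<^sup>2 - 1\<bar> / norm v"
          unfolding norm_divide norm_of_real complex_mod_cnj ..
        also have "\<dots> \<le> \<bar>(norm v)\<^sup>2 - 1\<bar> / m"
          using v \<open>0 < m\<close> by (intro divide_left_mono) auto
        finally show ?case by (simp add: v_def)
      qed
    qed
  qed (use \<open>0 < r\<close> in auto)
  have off: "F (cnj z) * cnj (F z) = 1" if "z \<in> ball 0 r" "Im z \<noteq> 0" for z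
    using F(2)[of z] F(2)[of "cnj z"] that nz[of z] nz[of "cnj z"]
    by (auto simp: g_def not_less)
  have "F (cnj z) * cnj (F z) = 1" if z: "z \<in> ball 0 r" for z
  proof (cases "Im z = 0")
    case True
    \<comment> \<open>A real point is approached from above, so that the identity off the axis
      passes to the limit by continuity of \<open>F\<close>.\<close>
    define w where "w n = z + \<i> * of_real (inverse (real (Suc n)))" for n
    have "(\<lambda>n. z + \<i> * of_real (inverse (real (Suc n)))) \<longlonglongrightarrow> z + \<i> * of_real 0"
      by (intro tendsto_intros LIMSEQ_inverse_real_of_nat)
    then have w: "w \<longlonglongrightarrow> z" by (simp add: w_def[abs_def])
    have "continuous_on (ball 0 r) (\<lambda>z. F (cnj z) * cnj (F z))"
      by (intro continuous_intros continuous_on_compose2[OF holomorphic_on_imp_continuous_on[OF F(1)]]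
           holomorphic_on_imp_continuous_on[OF F(1)]) auto
    then have "isCont (\<lambda>z. F (cnj z) * cnj (F z)) z"
      using z continuous_on_interior by fastforce
    from isCont_tendsto_compose[OF this w]
    have *: "(\<lambda>n. F (cnj (w n)) * cnj (F (w n))) \<longlonglongrightarrow> F (cnj z) * cnj (F z)" .
    have "\<forall>\<^sub>F n in sequentially. w n \<in> ball 0 r"
      using w z topological_tendstoD by blast
    then have "\<forall>\<^sub>F n in sequentially. F (cnj (w n)) * cnj (F (w n)) = 1"
    proof eventually_elim
      case (elim n)
      then show ?case using off[of "w n"] True by (auto simp: w_def)
    qed
    then have "(\<lambda>n. F (cnj (w n)) * cnj (F (w n))) \<longlonglongrightarrow> 1" by (rule tendsto_eventually)
    with * show ?thesis using LIMSEQ_unique by blast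
  qed (use off z in auto)
  with F show ?thesis using that by (auto simp: g_def)
qed

section \<open>Real analyticity in polar coordinates\<close>

text \<open>Exponents are pairs of naturals here, so that product and iterated sums apply directly;
  the indexing by extensional functions on \<open>Basis\<close> is recovered afterwards.\<close>

definition double_power_series_at :: "(real \<times> real \<Rightarrow> 'b::real_normed_vector) \<Rightarrow> real \<times> real \<Rightarrow> bool"
  where "double_power_series_at f p \<longleftrightarrow>
    (\<exists>e>0. \<exists>c. \<forall>x\<in>ball p e.
      ((\<lambda>(j, k). ((fst x - fst p) ^ j * (snd x - snd p) ^ k) *\<^sub>R c j k) has_sum f x) UNIV)"

lemma double_power_series_atE:
  assumes "double_power_series_at f p"
  obtains e c where "e > 0" "\<And>x. x \<in> ball p e \<Longrightarrow>
      ((\<lambda>(j, k). ((fst x - fst p) ^ j * (snd x - snd p) ^ k) *\<^sub>R c j k) has_sum f x) UNIV"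
  using assms unfolding double_power_series_at_def by blast

lemma real_analytic_on_double_power_series:
  assumes "\<And>p. p \<in> S \<Longrightarrow> double_power_series_at f p"
  shows "real_analytic_on f S"
  unfolding real_analytic_on_def
proof
  fix p assume "p \<in> S"
  obtain e c where e: "e > 0" and c: "\<And>x. x \<in> ball p e \<Longrightarrow>
      ((\<lambda>(j, k). ((fst x - fst p) ^ j * (snd x - snd p) ^ k) *\<^sub>R c j k) has_sum f x) UNIV"
    by (rule double_power_series_atE[OF assms[OF \<open>p \<in> S\<close>]], rule that; assumption)
  have B: "(Basis :: (real \<times> real) set) = {(1, 0), (0, 1)}"
    by (auto simp: Basis_prod_def)
  define h where "h \<kappa> = (\<kappa> (1, 0), \<kappa> (0, 1))" for \<kappa> :: "real \<times> real \<Rightarrow> nat"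
  \<comment> \<open>Extensional functions are \<open>undefined\<close> off \<open>Basis\<close>, so
    the inverse of \<open>h\<close> must return that value.\<close>
  define h' where "h' = (\<lambda>(j :: nat, k :: nat) b :: real \<times> real. if b = (1, 0) then j else if b = (0, 1) then k else undefined)"
  have bij: "bij_betw h (Basis \<rightarrow>\<^sub>E UNIV) UNIV"
    by (rule bij_betw_byWitness[of _ h'])
      (auto simp: h_def h'_def B fun_eq_iff PiE_def extensional_def)
  show "\<exists>e>0. \<exists>c. \<forall>x\<in>ball p e.
          ((\<lambda>k. (\<Prod>b\<in>Basis. ((x - p) \<bullet> b) ^ k b) *\<^sub>R c k) has_sum f x) (Basis \<rightarrow>\<^sub>E UNIV)"
  proof (intro exI[of _ e] conjI e exI[of _ "\<lambda>\<kappa>. c (\<kappa> (1, 0)) (\<kappa> (0, 1))"] ballI)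
    fix x assume "x \<in> ball p e"
    from c[OF this] show "((\<lambda>k. (\<Prod>b\<in>Basis. ((x - p) \<bullet> b) ^ k b) *\<^sub>R c (k (1, 0)) (k (0, 1))) has_sum f x)
                             (Basis \<rightarrow>\<^sub>E UNIV)"
      unfolding has_sum_reindex_bij_betw[OF bij, symmetric]
      by (simp add: h_def B inner_prod_def)
  qed
qed

lemma double_power_series_at_add:
  assumes "double_power_series_at f p" "double_power_series_at g p"
  shows "double_power_series_at (\<lambda>x. f x + g x) p"
proof -
  obtain e c where e: "e > 0" and c: "\<And>x. x \<in> ball p e \<Longrightarrow>
      ((\<lambda>(j, k). ((fst x - fst p) ^ j * (snd x - snd p) ^ k) *\<^sub>R c j k) has_sum f x) UNIV"
    by (rule double_power_series_atE[OF assms(1)], rule that; assumption)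
  obtain e' c' where e': "e' > 0" and c': "\<And>x. x \<in> ball p e' \<Longrightarrow>
      ((\<lambda>(j, k). ((fst x - fst p) ^ j * (snd x - snd p) ^ k) *\<^sub>R c' j k) has_sum g x) UNIV"
    by (rule double_power_series_atE[OF assms(2)], rule that; assumption)
  show ?thesis
    unfolding double_power_series_at_def
  proof (intro exI[of _ "min e e'"] conjI exI[of _ "\<lambda>j k. c j k + c' j k"] ballI)
    fix x assume "x \<in> ball p (min e e')"
    then have "x \<in> ball p e" "x \<in> ball p e'" by auto
    from has_sum_add[OF c[OF this(1)] c'[OF this(2)]]
    show "((\<lambda>(j, k). ((fst x - fst p) ^ j * (snd x - snd p) ^ k) *\<^sub>R (c j k + c' j k)) has_sum f x + g x) UNIV"
      by (simp add: case_prod_unfold scaleR_add_right)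
  qed (use e e' in auto)
qed

lemma double_power_series_at_bounded_linear:
  assumes "bounded_linear h" "double_power_series_at f p"
  shows "double_power_series_at (\<lambda>x. h (f x)) p"
proof -
  interpret bounded_linear h by fact
  obtain e c where e: "e > 0" and c: "\<And>x. x \<in> ball p e \<Longrightarrow>
      ((\<lambda>(j, k). ((fst x - fst p) ^ j * (snd x - snd p) ^ k) *\<^sub>R c j k) has_sum f x) UNIV"
    by (rule double_power_series_atE[OF assms(2)], rule that; assumption)
  show ?thesis
    unfolding double_power_series_at_def
    using has_sum_bounded_linear[OF assms(1) c]
    by (intro exI[of _ e] conjI exI[of _ "\<lambda>j k. h (c j k)"] ballI) (use e in \<open>auto simp: case_prod_unfold scaleR\<close>)
qed

lemma double_power_series_at_affine_snd:
  "double_power_series_at (\<lambda>x. a + snd x *\<^sub>R b) p"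
  unfolding double_power_series_at_def
proof (intro exI[of _ 1] conjI
    exI[of _ "\<lambda>j k. if j = 0 \<and> k = 0 then a + snd p *\<^sub>R b else if j = 0 \<and> k = 1 then b else 0"] ballI)
  fix x :: "real \<times> real"
  show "((\<lambda>(j, k). ((fst x - fst p) ^ j * (snd x - snd p) ^ k) *\<^sub>R
      (if j = 0 \<and> k = 0 then a + snd p *\<^sub>R b else if j = 0 \<and> k = 1 then b else 0)) has_sum a + snd x *\<^sub>R b) UNIV"
    by (rule has_sum_finite_neutralI[of "{(0, 0), (0, 1)}"]) (auto simp: algebra_simps split: if_splits)
qed simp

lemma has_sum_mult_nonneg:
  fixes f :: "'a \<Rightarrow> real" and g :: "'b \<Rightarrow> real"
  assumes "(f has_sum a) A" "(g has_sum b) B" "\<And>x. x \<in> A \<Longrightarrow> 0 \<le> f x" "\<And>y. y \<in> B \<Longrightarrow> 0 \<le> g y"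
  shows "((\<lambda>(x, y). f x * g y) has_sum a * b) (A \<times> B)"
proof (rule has_sum_SigmaI)
  show 1: "((\<lambda>y. case (x, y) of (x, y) \<Rightarrow> f x * g y) has_sum f x * b) B" for x
    using has_sum_cmult_right[OF assms(2), of "f x"] by simp
  show 2: "((\<lambda>x. f x * b) has_sum a * b) A"
    by (rule has_sum_cmult_left[OF assms(1)])
  show "(\<lambda>(x, y). f x * g y) summable_on A \<times> B"
    using 2 assms(3,4) by (intro summable_on_SigmaI[OF 1]) (auto simp: summable_on_def)
qed

lemma has_sum_mult_complex:
  fixes f :: "'a \<Rightarrow> complex" and g :: "'b \<Rightarrow> complex"
  assumes "(f has_sum a) A" "(g has_sum b) B" "(\<lambda>x. norm (f x)) summable_on A" "(\<lambda>x. norm (g x)) summable_on B"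
  shows "((\<lambda>(x, y). f x * g y) has_sum a * b) (A \<times> B)"
proof (rule has_sum_SigmaI)
  show "((\<lambda>y. case (x, y) of (x, y) \<Rightarrow> f x * g y) has_sum f x * b) B" for x
    using has_sum_cmult_right[OF assms(2), of "f x"] by simp
  show "((\<lambda>x. f x * b) has_sum a * b) A"
    by (rule has_sum_cmult_left[OF assms(1)])
  have "(\<lambda>(x, y). norm (f x) * norm (g y)) summable_on A \<times> B"
    using has_sum_mult_nonneg[where f = "\<lambda>x. norm (f x)" and A = A and g = "\<lambda>y. norm (g y)" and B = B] assms(3,4)
    by (fastforce simp: summable_on_def)
  then have "(\<lambda>p. norm ((\<lambda>(x, y). f x * g y) p)) summable_on A \<times> B"
    by (simp add: case_prod_unfold norm_mult)
  then show "(\<lambda>(x, y). f x * g y) summable_on A \<times> B"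
    by (rule abs_summable_summable)
qed

text \<open>
  Expanding \<open>(\<rho> + u)\<^sup>n\<close> by the binomial theorem and \<open>e\<^sup>i\<^sup>n\<^sup>v\<close> by the exponential series in
  \<open>\<Sum>n. a\<^sub>n (\<rho> + u)\<^sup>n e\<^sup>i\<^sup>n\<^sup>(\<^sup>\<alpha>\<^sup>+\<^sup>v\<^sup>)\<close> gives an absolutely convergent triple series,
  dominated by \<open>\<Sum>n. \<bar>a\<^sub>n\<bar> ((\<bar>\<rho>\<bar> + \<bar>u\<bar>) e\<^sup>\<bar>\<^sup>v\<^sup>\<bar>)\<^sup>n\<close>.
\<close>
lemma double_power_series_at_holomorphic_rcis:
  fixes H :: "complex \<Rightarrow> complex" and R :: real and p :: "real \<times> real"
  assumes hol: "H holomorphic_on ball 0 R" and p: "\<bar>fst p\<bar> < R"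
  shows "double_power_series_at (\<lambda>x. H (rcis (fst x) (snd x))) p"
proof -
  define \<rho> \<alpha> where "\<rho> = fst p" and "\<alpha> = snd p"
  define a where "a n = (deriv ^^ n) H 0 / fact n" for n
  have series: "(\<lambda>n. a n * w ^ n) sums H w" if "norm w < R" for w
    using holomorphic_power_series[OF hol, of w] that by (simp add: a_def)
  \<comment> \<open>A radius strictly between |\<rho>| and R: the power series of \<open>H\<close>
    converges absolutely at \<open>s\<close>, and this dominates all rearrangements below.\<close>
  define s where "s = (\<bar>\<rho>\<bar> + R) / 2"
  have s: "\<bar>\<rho>\<bar> < s" "s < R" "0 < s" using p by (auto simp: s_def \<rho>_def)
  have sum_s: "summable (\<lambda>n. norm (a n) * s ^ n)"
  proof -
    obtain t where t: "s < t" "t < R" using s dense by blast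
    then have "summable (\<lambda>n. a n * of_real t ^ n)"
      using series[of "of_real t"] s by (auto simp: sums_iff)
    from powser_insidea[OF this, of "of_real s"] show ?thesis
      using s t by (simp add: norm_mult norm_power)
  qed
  \<comment> \<open>The limit |\<rho>| is below s, so one \<open>e\<close> controls the radial and
    the angular increment at once.\<close>
  have "((\<lambda>e. (\<bar>\<rho>\<bar> + e) * exp e) \<longlongrightarrow> (\<bar>\<rho>\<bar> + 0) * exp 0) (at_right 0)"
    by (intro tendsto_intros)
  then have "\<forall>\<^sub>F e in at_right 0. (\<bar>\<rho>\<bar> + e) * exp e < s"
    using s by (intro order_tendstoD) auto
  then have "\<forall>\<^sub>F e in at_right 0. 0 < e \<and> (\<bar>\<rho>\<bar> + e) * exp e < s"
    by (intro eventually_conj eventually_at_right_less)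
  then obtain e where e: "0 < e" "(\<bar>\<rho>\<bar> + e) * exp e < s"
    using eventually_happens'[OF trivial_limit_at_right_real, of "\<lambda>e. 0 < e \<and> (\<bar>\<rho>\<bar> + e) * exp e < s" 0] by blast
  \<comment> \<open>The contribution of the n-th Taylor term of \<open>H\<close> to the coefficient
    of u^j v^k. For j > n the binomial coefficient is 0, so the truncated exponent
    \<open>n - j\<close> does no harm.\<close>
  define cc where "cc j k n = a n * cis \<alpha> ^ n * of_real (real (n choose j) * \<rho> ^ (n - j)) * ((\<i> * of_nat n) ^ k /\<^sub>R fact k)"
    for j k n
  define T where "T u v = (\<lambda>(n, j, k). (u ^ j * v ^ k) *\<^sub>R cc j k n)" for u v :: real
  have T: "T u v summable_on UNIV \<times> UNIV"
          "(T u v has_sum H (rcis (\<rho> + u) (\<alpha> + v))) (UNIV \<times> UNIV)" if uv: "\<bar>u\<bar> < e" "\<bar>v\<bar> < e" for u v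
  proof -
    define A where "A n j = complex_of_real (real (n choose j) * u ^ j * \<rho> ^ (n - j))" for n j
    define B where "B n k = (\<i> * of_nat n * of_real v) ^ k /\<^sub>R fact k" for n k
    have T_eq: "T u v (n, j, k) = a n * cis \<alpha> ^ n * (A n j * B n k)" for n j k
      unfolding T_def cc_def A_def B_def case_prod_conv scaleR_conv_of_real of_real_mult of_real_power power_mult_distrib
      by (simp only: mult_ac)
    have T_eq': "T u v (n, jk) = a n * cis \<alpha> ^ n * (A n (fst jk) * B n (snd jk))" for n jk
      using T_eq[of n "fst jk" "snd jk"] by simp
    have A_sum: "(A n has_sum of_real (\<rho> + u) ^ n) UNIV" for n
      by (rule has_sum_finite_neutralI[of "{..n}"])
        (simp_all add: A_def add.commute[of \<rho>] binomial_ring of_real_add)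
    have A_norm: "((\<lambda>j. norm (A n j)) has_sum (\<bar>\<rho>\<bar> + \<bar>u\<bar>) ^ n) UNIV" for n
      by (rule has_sum_finite_neutralI[of "{..n}"])
        (simp_all add: A_def add.commute[of "\<bar>\<rho>\<bar>"] binomial_ring norm_mult norm_power)
    have B_sum: "(B n has_sum exp (\<i> * of_nat n * of_real v)) UNIV" for n
      unfolding B_def by (intro norm_summable_imp_has_sum summable_norm_exp exp_converges)
    have "norm (B n k) = (real n * \<bar>v\<bar>) ^ k /\<^sub>R fact k" for n k
      by (simp add: B_def norm_mult norm_power norm_divide)
    moreover have "((\<lambda>k. (real n * \<bar>v\<bar>) ^ k /\<^sub>R fact k) has_sum exp (real n * \<bar>v\<bar>)) UNIV" for n
      by (intro norm_summable_imp_has_sum summable_norm_exp exp_converges)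
    ultimately have B_norm: "((\<lambda>k. norm (B n k)) has_sum exp (real n * \<bar>v\<bar>)) UNIV" for n
      by simp
    have norm_sum: "((\<lambda>jk. norm (T u v (n, jk))) has_sum norm (a n) * ((\<bar>\<rho>\<bar> + \<bar>u\<bar>) ^ n * exp (real n * \<bar>v\<bar>))) UNIV" for n
      using has_sum_cmult_right[OF has_sum_mult_nonneg[OF A_norm[of n] B_norm[of n]], where c = "norm (a n)"]
      by (simp add: case_prod_unfold T_eq' norm_mult norm_power)
    have le: "norm (a n) * ((\<bar>\<rho>\<bar> + \<bar>u\<bar>) ^ n * exp (real n * \<bar>v\<bar>)) \<le> norm (a n) * s ^ n" for n
    proof -
      have "(\<bar>\<rho>\<bar> + \<bar>u\<bar>) ^ n * exp (real n * \<bar>v\<bar>) = ((\<bar>\<rho>\<bar> + \<bar>u\<bar>) * exp \<bar>v\<bar>) ^ n"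
        by (simp only: power_mult_distrib exp_of_nat_mult)
      also have "\<dots> \<le> s ^ n"
      proof (rule power_mono)
        have "(\<bar>\<rho>\<bar> + \<bar>u\<bar>) * exp \<bar>v\<bar> \<le> (\<bar>\<rho>\<bar> + e) * exp e"
          using uv by (intro mult_mono) auto
        then show "(\<bar>\<rho>\<bar> + \<bar>u\<bar>) * exp \<bar>v\<bar> \<le> s" using e by simp
      qed auto
      finally show ?thesis by (intro mult_left_mono) auto
    qed
    have "(\<lambda>n. norm (a n) * ((\<bar>\<rho>\<bar> + \<bar>u\<bar>) ^ n * exp (real n * \<bar>v\<bar>))) summable_on UNIV"
    proof (rule norm_summable_imp_summable_on, rule summable_comparison_test'[OF sum_s, of 0])
      show "norm (norm (norm (a n) * ((\<bar>\<rho>\<bar> + \<bar>u\<bar>) ^ n * exp (real n * \<bar>v\<bar>)))) \<le> norm (a n) * s ^ n" for n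
        using le[of n] unfolding real_norm_def abs_abs by (subst abs_of_nonneg) auto
    qed
    then have "(\<lambda>x. norm (T u v x)) summable_on UNIV \<times> UNIV"
      by (rule summable_on_SigmaI[OF norm_sum]) auto
    then show summ: "T u v summable_on UNIV \<times> UNIV" by (rule abs_summable_summable)
    show "(T u v has_sum H (rcis (\<rho> + u) (\<alpha> + v))) (UNIV \<times> UNIV)"
    proof (rule has_sum_SigmaI[OF _ _ summ])
      define w where "w = rcis (\<rho> + u) (\<alpha> + v)"
      have "\<bar>\<rho>\<bar> + e \<le> (\<bar>\<rho>\<bar> + e) * exp e"
        using e mult_left_mono[of 1 "exp e" "\<bar>\<rho>\<bar> + e"] by simp
      then have w: "norm w < s" using uv e by (simp add: w_def)
      show "((\<lambda>jk. T u v (n, jk)) has_sum a n * w ^ n) UNIV" for n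
      proof -
        have "((\<lambda>jk. T u v (n, jk)) has_sum a n * cis \<alpha> ^ n * (of_real (\<rho> + u) ^ n * exp (\<i> * of_nat n * of_real v))) UNIV"
          using has_sum_cmult_right[OF has_sum_mult_complex[OF A_sum[of n] B_sum[of n]], where c = "a n * cis \<alpha> ^ n"] 
            A_norm B_norm
          by (auto simp: summable_on_def case_prod_unfold T_eq' simp flip: UNIV_Times_UNIV)
        moreover have "exp (\<i> * of_nat n * of_real v) = cis v ^ n"
          by (simp add: cis_conv_exp mult_ac flip: exp_of_nat_mult)
        moreover have "w = of_real (\<rho> + u) * (cis \<alpha> * cis v)"
          by (simp add: w_def rcis_def cis_mult)
        ultimately show ?thesis by (simp add: power_mult_distrib mult_ac)
      qed
      show "((\<lambda>n. a n * w ^ n) has_sum H w) UNIV"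
      proof (rule norm_summable_imp_has_sum)
        show "summable (\<lambda>n. norm (a n * w ^ n))"
          using sum_s by (rule summable_comparison_test'[of _ 0])
            (use w in \<open>auto simp: norm_mult norm_power intro!: mult_left_mono power_mono\<close>)
      qed (use series w s in auto)
    qed
  qed
  \<comment> \<open>The triple series converges at u = v = e/2; fixing j and k leaves the
    coefficients times a nonzero factor, which is divided out.\<close>
  have cc_sum: "cc j k summable_on UNIV" for j k
  proof -
    have "(\<lambda>(n, jk). T (e/2) (e/2) (n, jk)) summable_on UNIV \<times> UNIV"
      using T(1)[of "e/2" "e/2"] e by simp
    then have "(\<lambda>(jk, n). T (e/2) (e/2) (n, jk)) summable_on UNIV \<times> UNIV"
      by (subst (asm) summable_on_swap) (simp add: case_prod_unfold)
    then have "(\<lambda>n. T (e/2) (e/2) (n, (j, k))) summable_on UNIV"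
      by (rule summable_on_SigmaD1) simp
    then have "(\<lambda>n. (1 / ((e/2) ^ j * (e/2) ^ k)) *\<^sub>R (((e/2) ^ j * (e/2) ^ k) *\<^sub>R cc j k n)) summable_on UNIV"
      unfolding T_def case_prod_conv by (rule summable_on_scaleR_right)
    then show ?thesis using e by simp
  qed
  show ?thesis
    unfolding double_power_series_at_def
  proof (intro exI[of _ e] conjI exI[of _ "\<lambda>j k. infsum (cc j k) UNIV"] ballI)
    fix x assume "x \<in> ball p e"
    then have "\<bar>fst x - \<rho>\<bar> < e" "\<bar>snd x - \<alpha>\<bar> < e"
      using dist_fst_le[of p x] dist_snd_le[of p x] by (auto simp: \<rho>_def \<alpha>_def dist_real_def)
    \<comment> \<open>Summing over n first collects the coefficient of each monomial.\<close>
    from T(2)[OF this]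
    have "((\<lambda>(jk, n). T (fst x - \<rho>) (snd x - \<alpha>) (n, jk)) has_sum H (rcis (fst x) (snd x))) (UNIV \<times> UNIV)"
      by (subst (asm) has_sum_swap) (simp add: case_prod_unfold)
    then have "((\<lambda>jk. case jk of (j, k) \<Rightarrow> ((fst x - \<rho>) ^ j * (snd x - \<alpha>) ^ k) *\<^sub>R infsum (cc j k) UNIV) has_sum
                 H (rcis (fst x) (snd x))) UNIV"
    proof (rule has_sum_SigmaD)
      fix jk :: "nat \<times> nat"
      obtain j k where jk: "jk = (j, k)" by force
      show "((\<lambda>n. case (jk, n) of (jk, n) \<Rightarrow> T (fst x - \<rho>) (snd x - \<alpha>) (n, jk)) has_sum
              (case jk of (j, k) \<Rightarrow> ((fst x - \<rho>) ^ j * (snd x - \<alpha>) ^ k) *\<^sub>R infsum (cc j k) UNIV)) UNIV"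
        unfolding jk T_def case_prod_conv
        by (intro has_sum_bounded_linear[OF bounded_linear_scaleR_right] has_sum_infsum cc_sum)
    qed
    then show "((\<lambda>(j, k). ((fst x - fst p) ^ j * (snd x - snd p) ^ k) *\<^sub>R infsum (cc j k) UNIV) has_sum
                 H (rcis (fst x) (snd x))) UNIV"
      by (simp add: \<rho>_def \<alpha>_def)
  qed (rule e)
qed

section \<open>Harmonic functions as real parts\<close>

text \<open>Schwarz's theorem, since \<open>harmonic_on\<close> treats the two mixed partials as
  separate functions. The second difference of \<open>u\<close> over a square of side h is h^2 times
  either mixed partial at some point of the square, by the mean value theorem applied in the two
  orders; then h tends to 0.\<close>

lemma mixed_partials_eq:
  fixes u ux uy uxx uxy uyx uyy :: "complex \<Rightarrow> real"
  assumes "open S" "z \<in> S"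
    and u: "\<And>z. z \<in> S \<Longrightarrow> (u has_derivative (\<lambda>w. ux z * Re w + uy z * Im w)) (at z)"
    and ux: "\<And>z. z \<in> S \<Longrightarrow> (ux has_derivative (\<lambda>w. uxx z * Re w + uxy z * Im w)) (at z)"
    and uy: "\<And>z. z \<in> S \<Longrightarrow> (uy has_derivative (\<lambda>w. uyx z * Re w + uyy z * Im w)) (at z)"
    and cont: "continuous_on S uxy" "continuous_on S uyx"
  shows "uxy z = uyx z"
proof -
  have hor: "((\<lambda>s. f (z + Complex s t)) has_real_derivative a (z + Complex s t)) (at s)"
    if "(f has_derivative (\<lambda>w. a (z + Complex s t) * Re w + b (z + Complex s t) * Im w)) (at (z + Complex s t))" for f a b s t
  proof -
    have "((\<lambda>s. z + Complex s t) has_derivative (\<lambda>s. Complex s 0)) (at s)"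
      unfolding Complex_eq by (auto intro!: derivative_eq_intros)
    from diff_chain_at[OF this that] show ?thesis
      by (simp add: o_def has_field_derivative_def)
  qed
  have ver: "((\<lambda>t. f (z + Complex s t)) has_real_derivative b (z + Complex s t)) (at t)"
    if "(f has_derivative (\<lambda>w. a (z + Complex s t) * Re w + b (z + Complex s t) * Im w)) (at (z + Complex s t))" for f a b s t
  proof -
    have "((\<lambda>t. z + Complex s t) has_derivative (\<lambda>t. Complex 0 t)) (at t)"
      unfolding Complex_eq by (auto intro!: derivative_eq_intros)
    from diff_chain_at[OF this that] show ?thesis
      by (simp add: o_def has_field_derivative_def)
  qed
  obtain r where r: "0 < r" "ball z r \<subseteq> S" using assms(1,2) openE by blast
  \<comment> \<open>A point of the square has distance at most s + t from z, hence the factor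
    2.\<close>
  have inS: "z + Complex s t \<in> S" if "0 \<le> s" "s \<le> h" "0 \<le> t" "t \<le> h" "2 * h < r" for s t h
    using cmod_le[of "Complex s t"] that r(2) by (auto simp: dist_norm)
  have ex: "\<exists>p q. dist p z \<le> 2 * h \<and> dist q z \<le> 2 * h \<and> p \<in> S \<and> q \<in> S \<and> uxy p = uyx q" 
    if h: "0 < h" "2 * h < r" for h
  proof -
    define \<Delta> where "\<Delta> = u (z + Complex h h) - u (z + Complex h 0) - u (z + Complex 0 h) + u (z + Complex 0 0)"
    obtain s1 where s1: "0 < s1" "s1 < h"
        "(u (z + Complex h h) - u (z + Complex h 0)) - (u (z + Complex 0 h) - u (z + Complex 0 0)) =
         (h - 0) * (ux (z + Complex s1 h) - ux (z + Complex s1 0))"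
      using MVT2[of 0 h "\<lambda>s. u (z + Complex s h) - u (z + Complex s 0)" "\<lambda>s. ux (z + Complex s h) - ux (z + Complex s 0)"]
        h inS[of _ h _] by (force intro!: DERIV_diff hor u)
    obtain t1 where t1: "0 < t1" "t1 < h"
        "ux (z + Complex s1 h) - ux (z + Complex s1 0) = (h - 0) * uxy (z + Complex s1 t1)"
      using MVT2[of 0 h "\<lambda>t. ux (z + Complex s1 t)" "\<lambda>t. uxy (z + Complex s1 t)"]
        h s1 inS[of _ h _] by (force intro!: ver ux)
    obtain t2 where t2: "0 < t2" "t2 < h"
        "(u (z + Complex h h) - u (z + Complex 0 h)) - (u (z + Complex h 0) - u (z + Complex 0 0)) =
         (h - 0) * (uy (z + Complex h t2) - uy (z + Complex 0 t2))"
      using MVT2[of 0 h "\<lambda>t. u (z + Complex h t) - u (z + Complex 0 t)" "\<lambda>t. uy (z + Complex h t) - uy (z + Complex 0 t)"]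
        h inS[of _ h _] by (force intro!: DERIV_diff ver u)
    obtain s2 where s2: "0 < s2" "s2 < h"
        "uy (z + Complex h t2) - uy (z + Complex 0 t2) = (h - 0) * uyx (z + Complex s2 t2)"
      using MVT2[of 0 h "\<lambda>s. uy (z + Complex s t2)" "\<lambda>s. uyx (z + Complex s t2)"]
        h t2 inS[of _ h _] by (force intro!: hor uy)
    have "h * (h * uxy (z + Complex s1 t1)) = h * (h * uyx (z + Complex s2 t2))"
      using s1(3)[unfolded t1(3) diff_zero] t2(3)[unfolded s2(3) diff_zero] by linarith
    then have "uxy (z + Complex s1 t1) = uyx (z + Complex s2 t2)" using h by simp
    moreover have "dist (z + Complex s1 t1) z \<le> 2 * h" "dist (z + Complex s2 t2) z \<le> 2 * h"
      using cmod_le[of "Complex s1 t1"] cmod_le[of "Complex s2 t2"] s1 t1 s2 t2 by (auto simp: dist_norm)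
    ultimately show ?thesis
      using inS[of s1 h t1] inS[of s2 h t2] s1 t1 s2 t2 h by force
  qed
  define h where "h n = r / 4 / real (Suc n)" for n
  have "0 < h n \<and> 2 * h n < r" for n using r(1) by (auto simp: h_def field_simps intro!: add_pos_nonneg)
  then have "\<forall>n. \<exists>p q. dist p z \<le> 2 * h n \<and> dist q z \<le> 2 * h n \<and> p \<in> S \<and> q \<in> S \<and> uxy p = uyx q"
    using ex by blast
  then obtain p q where pq: "dist (p n) z \<le> 2 * h n" "dist (q n) z \<le> 2 * h n" "p n \<in> S" "q n \<in> S"
      "uxy (p n) = uyx (q n)" for n
    by metis
  have "h \<longlonglongrightarrow> 0" unfolding h_def by real_asymp
  from tendsto_mult_right_zero[OF this, of 2] have h2: "(\<lambda>n. 2 * h n) \<longlonglongrightarrow> 0" .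
  have "p \<longlonglongrightarrow> z" "q \<longlonglongrightarrow> z"
    using pq(1,2) by (auto intro!: metric_tendsto_imp_tendsto[OF h2] always_eventually simp: dist_real_def order_trans[OF _ abs_ge_self])
  then have "(\<lambda>n. uxy (p n)) \<longlonglongrightarrow> uxy z" "(\<lambda>n. uyx (q n)) \<longlonglongrightarrow> uyx z"
    by (auto intro!: continuous_on_tendsto_compose[OF cont(1)] continuous_on_tendsto_compose[OF cont(2)]
          always_eventually pq(3,4) \<open>z \<in> S\<close>)
  then show ?thesis using pq(5) LIMSEQ_unique by simp
qed

text \<open>The Cauchy-Riemann equations for u_x - i u_y are Laplace's equation and the symmetry of
  the mixed partials. Simple connectivity gives a primitive, whose real part has the same gradient
  as \<open>u\<close>.\<close>

lemma harmonic_on_eq_Re_holomorphic: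
  assumes "harmonic_on u S" "open S" "simply_connected S"
  obtains P where "P holomorphic_on S" "\<And>z. z \<in> S \<Longrightarrow> u z = Re (P z)"
proof (cases "S = {}")
  case False
  then obtain z0 where z0: "z0 \<in> S" by blast
  obtain ux uy uxx uxy uyx uyy where
        u: "\<And>z. z \<in> S \<Longrightarrow> (u has_derivative (\<lambda>w. ux z * Re w + uy z * Im w)) (at z)"
    and ux: "\<And>z. z \<in> S \<Longrightarrow> (ux has_derivative (\<lambda>w. uxx z * Re w + uxy z * Im w)) (at z)"
    and uy: "\<And>z. z \<in> S \<Longrightarrow> (uy has_derivative (\<lambda>w. uyx z * Re w + uyy z * Im w)) (at z)"
    and cont: "continuous_on S uxy" "continuous_on S uyx"
    and lap: "\<And>z. z \<in> S \<Longrightarrow> uxx z + uyy z = 0"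
    using assms(1) unfolding harmonic_on_def by blast
  define p where "p z = of_real (ux z) - \<i> * of_real (uy z)" for z
  have "(p has_field_derivative (of_real (uxx z) - \<i> * of_real (uyx z))) (at z)" if z: "z \<in> S" for z
  proof -
    have "uyx z = uxy z" using mixed_partials_eq[OF assms(2) z u ux uy cont] by simp
    moreover have "uyy z = - uxx z" using lap[OF z] by simp
    moreover have "(p has_derivative (\<lambda>w. of_real (uxx z * Re w + uxy z * Im w) - \<i> * of_real (uyx z * Re w + uyy z * Im w))) (at z)"
      unfolding p_def by (intro derivative_intros ux uy z)
    ultimately have "(p has_derivative (\<lambda>w. (of_real (uxx z) - \<i> * of_real (uyx z)) * w)) (at z)"
      by (elim has_derivative_eq_rhs) (auto simp: fun_eq_iff complex_eq_iff algebra_simps)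
    then show ?thesis by (simp add: has_field_derivative_def)
  qed
  then have "p holomorphic_on S" using assms(2) holomorphic_on_open by blast
  then obtain P where P: "\<And>z. z \<in> S \<Longrightarrow> (P has_field_derivative p z) (at z)"
    using simply_connected_eq_global_primitive[OF assms(2)] assms(3) by blast
  have "((\<lambda>z. u z - Re (P z)) has_derivative (\<lambda>w. 0)) (at z)" if z: "z \<in> S" for z
  proof -
    have "(P has_derivative (\<lambda>w. p z * w)) (at z)" using P[OF z] by (simp add: has_field_derivative_def)
    from has_derivative_diff[OF u[OF z] has_derivative_Re[OF this]]
    show ?thesis by (simp add: p_def)
  qed
  then have const: "u z - Re (P z) = u z0 - Re (P z0)" if "z \<in> S" for z
    using has_derivative_zero_unique_connected[OF assms(2) simply_connected_imp_connected[OF assms(3)]] that z0 by blast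
  show ?thesis
  proof (rule that)
    show "(\<lambda>z. P z + of_real (u z0 - Re (P z0))) holomorphic_on S"
      using P assms(2) holomorphic_on_open by (intro holomorphic_intros) blast
    show "u z = Re (P z + of_real (u z0 - Re (P z0)))" if "z \<in> S" for z
      using const[OF that] by simp
  qed
next
  case True
  then show ?thesis using that[of "\<lambda>_. 0"] by simp
qed

section \<open>Boundary charts\<close>

text \<open>The equivalence fixes the side and also places the real diameter: its points are sent
  outside \<Omega> but to limits of points of \<Omega>, hence to the frontier.\<close>

definition boundary_chart :: "complex set \<Rightarrow> complex \<Rightarrow> real \<Rightarrow> (complex \<Rightarrow> complex) \<Rightarrow> bool"
  where "boundary_chart \<Omega> p r g \<longleftrightarrow> 0 < r \<and> g holomorphic_on ball 0 r \<and> inj_on g (ball 0 r) \<and> g 0 = p \<and>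
    (\<forall>z\<in>ball 0 r. g z \<in> \<Omega> \<longleftrightarrow> 0 < Im z)"

text \<open>Off the real axis \<open>G\<close> avoids the frontier, because inside \<open>U\<close>
  the frontier is exactly the arc and \<open>G\<close> is injective; so the connected image of each
  half-disc lies in \<Omega> or misses it. By the Jordan curve theorem both inside and outside
  accumulate at the point, hence exactly one half goes into \<Omega>.\<close>

lemma boundary_chart_exists:
  fixes G :: "complex \<Rightarrow> complex" and I :: "real set" and s :: real
  assumes "Jordan_domain \<Omega>" "open U" "open I" "s \<in> I" "G (of_real s) \<in> U"
    and \<Gamma>: "frontier \<Omega> \<inter> U = (\<lambda>x. G (of_real x)) ` I"
    and N: "open N" "complex_of_real ` I \<subseteq> N" "G holomorphic_on N" "inj_on G N"
  obtains r \<epsilon> where "\<epsilon> = 1 \<or> \<epsilon> = -1" "boundary_chart \<Omega> (G (of_real s)) r (\<lambda>z. G (of_real s + of_real \<epsilon> * z))"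
    "\<And>z. z \<in> ball 0 r \<Longrightarrow> of_real s + of_real \<epsilon> * z \<in> N"
    "\<And>x. \<bar>x\<bar> < r \<Longrightarrow> s + \<epsilon> * x \<in> I"
proof -
  obtain c where c: "simple_path c" "pathfinish c = pathstart c" "\<Omega> = inside (path_image c)"
    using assms(1) by (auto simp: Jordan_domain_def)
  note J = Jordan_inside_outside[OF c(1,2)]
  have fr: "frontier \<Omega> = path_image c" "frontier (outside (path_image c)) = path_image c"
    and op\<Omega>: "open \<Omega>" "open (outside (path_image c))" and disj: "\<Omega> \<inter> outside (path_image c) = {}"
    using J c(3) by auto
  have "open (N \<inter> G -` U)"
    using N assms(2) continuous_open_preimage holomorphic_on_imp_continuous_on by blast
  moreover have "of_real s \<in> N \<inter> G -` U" using assms N by auto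
  ultimately obtain d1 where d1: "0 < d1" "ball (of_real s) d1 \<subseteq> N \<inter> G -` U" using openE by blast
  obtain d2 where d2: "0 < d2" "ball s d2 \<subseteq> I" using openE assms(3,4) by blast
  define r where "r = min d1 d2"
  define B where "B = ball (complex_of_real s) r"
  have r: "0 < r" "B \<subseteq> N" "G ` B \<subseteq> U" "ball s r \<subseteq> I" using d1 d2 by (auto simp: r_def B_def)
  have front: "G z \<in> frontier \<Omega> \<longleftrightarrow> Im z = 0" if z: "z \<in> B" for z
  proof
    assume "G z \<in> frontier \<Omega>"
    then have "G z \<in> (\<lambda>x. G (of_real x)) ` I" using \<Gamma> r z by blast
    then obtain x where "x \<in> I" "G z = G (of_real x)" by blast
    then have "z = of_real x" using inj_onD[OF N(4), of z "of_real x"] N(2) r(2) z by blast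
    then show "Im z = 0" by simp
  next
    assume im: "Im z = 0"
    then have zr: "z = of_real (Re z)" by (simp add: complex_eq_iff)
    have "Re z \<in> ball s r" using z abs_Re_le_cmod[of "of_real s - z"] by (auto simp: B_def dist_norm)
    then have "G (of_real (Re z)) \<in> frontier \<Omega>" using r(4) \<Gamma> by blast
    then show "G z \<in> frontier \<Omega>" by (simp flip: zr)
  qed
  define Bu where "Bu = B \<inter> {z. 0 < Im z}"
  define Bl where "Bl = B \<inter> {z. Im z < 0}"
  have conn: "connected (G ` Bu)" "connected (G ` Bl)"
    by (rule connected_continuous_image; use r(2) in \<open>auto intro!: convex_connected convex_Int convex_halfspace_Im_gt
        convex_halfspace_Im_lt continuous_on_subset[OF holomorphic_on_imp_continuous_on[OF N(3)]] simp: Bu_def Bl_def B_def\<close>)+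
  have alt: "G ` T \<subseteq> \<Omega> \<or> G ` T \<inter> \<Omega> = {}" if "T = Bu \<or> T = Bl" for T
  proof -
    have "G ` T \<inter> frontier \<Omega> = {}" using that front by (fastforce simp: Bu_def Bl_def)
    then show ?thesis using that conn connected_Int_frontier[of "G ` T" \<Omega>] by blast
  qed
  have opGB: "open (G ` B)"
    using r(2) by (intro open_mapping_thm3 holomorphic_on_subset[OF N(3)] inj_on_subset[OF N(4)]) (auto simp: B_def)
  have pGB: "G (of_real s) \<in> G ` B" using r by (simp add: B_def)
  have pfr: "G (of_real s) \<in> path_image c" using front[of "of_real s"] r fr by (simp add: B_def)
  have meets: "\<exists>z\<in>Bu \<union> Bl. G z \<in> T" if T: "open T" "frontier T = path_image c" for T
  proof -
    have "G (of_real s) \<in> closure T" using T pfr by (auto simp: frontier_def)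
    then obtain z where z: "z \<in> B" "G z \<in> T"
      using opGB pGB open_Int_closure_eq_empty[OF opGB, of T] by blast
    moreover have "T \<inter> frontier T = {}" using T(1) frontier_disjoint_eq by blast
    ultimately have "Im z \<noteq> 0" using front[OF z(1)] T fr by blast
    then show ?thesis using z by (auto simp: Bu_def Bl_def intro!: bexI[of _ z])
  qed
  have one: "(G ` Bu \<subseteq> \<Omega> \<and> G ` Bl \<inter> \<Omega> = {}) \<or> (G ` Bl \<subseteq> \<Omega> \<and> G ` Bu \<inter> \<Omega> = {})"
    using meets[OF op\<Omega>(1) fr(1)] meets[OF op\<Omega>(2) fr(2)] alt[of Bu] alt[of Bl] disj by blast
  have real_out: "G z \<notin> \<Omega>" if "z \<in> B" "Im z = 0" for z
    using front[OF that(1)] that op\<Omega>(1) frontier_disjoint_eq by blast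
  \<comment> \<open>The disc is given a half-turn when the lower half goes into \<Omega>; a
    rotation, unlike conjugation, keeps the chart holomorphic.\<close>
  define \<epsilon> :: real where "\<epsilon> = (if G ` Bu \<subseteq> \<Omega> then 1 else -1)"
  have \<epsilon>: "\<epsilon> = 1 \<or> \<epsilon> = -1" by (simp add: \<epsilon>_def)
  define k where "k z = complex_of_real s + of_real \<epsilon> * z" for z
  have kB: "k z \<in> B" if "z \<in> ball 0 r" for z
    using that \<epsilon> by (auto simp: k_def B_def dist_norm)
  have Bu0: "Bu \<noteq> {}"
  proof -
    have "of_real s + \<i> * of_real (r/2) \<in> Bu" using r(1) by (simp add: Bu_def B_def dist_norm norm_mult)
    then show ?thesis by blast
  qed
  have side: "G (k z) \<in> \<Omega> \<longleftrightarrow> 0 < Im z" if z: "z \<in> ball 0 r" for z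
  proof (cases "Im z = 0")
    case True
    then show ?thesis using real_out[OF kB[OF z]] by (simp add: k_def)
  next
    case False
    show ?thesis
    proof (cases "G ` Bu \<subseteq> \<Omega>")
      case True
      then have "G ` Bl \<inter> \<Omega> = {}" using one Bu0 by blast
      moreover have "\<epsilon> = 1" using True by (simp add: \<epsilon>_def)
      then have "0 < Im z \<Longrightarrow> k z \<in> Bu" "\<not> 0 < Im z \<Longrightarrow> k z \<in> Bl"
        using False kB[OF z] by (auto simp: Bu_def Bl_def k_def)
      ultimately show ?thesis using True by blast
    next
      case no: False
      then have "G ` Bl \<subseteq> \<Omega>" "G ` Bu \<inter> \<Omega> = {}" using one by blast+
      moreover have "\<epsilon> = -1" using no by (simp add: \<epsilon>_def)
      then have "0 < Im z \<Longrightarrow> k z \<in> Bl" "\<not> 0 < Im z \<Longrightarrow> k z \<in> Bu"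
        using False kB[OF z] by (auto simp: Bu_def Bl_def k_def)
      ultimately show ?thesis by blast
    qed
  qed
  have inj_k: "inj_on k (ball 0 r)" using \<epsilon> by (auto simp: k_def inj_on_def)
  have "boundary_chart \<Omega> (G (of_real s)) r (\<lambda>z. G (k z))"
    unfolding boundary_chart_def
  proof (intro conjI ballI side r(1))
    show "(\<lambda>z. G (k z)) holomorphic_on ball 0 r"
    proof -
      have "k holomorphic_on ball 0 r" unfolding k_def by (intro holomorphic_intros)
      moreover have "k ` ball 0 r \<subseteq> N" using kB r(2) by blast
      ultimately show ?thesis using holomorphic_on_compose_gen[OF _ N(3)] by (auto simp: o_def)
    qed
    show "inj_on (\<lambda>z. G (k z)) (ball 0 r)"
      using inj_k N(4) kB r(2) unfolding inj_on_def by (meson subsetD)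
  qed (simp_all add: k_def)
  moreover have "s + \<epsilon> * x \<in> I" if "\<bar>x\<bar> < r" for x
    using that \<epsilon> r(4) by (auto simp: dist_real_def)
  ultimately show ?thesis using that[OF \<epsilon>, of r] kB r(2) by (auto simp: k_def)
qed

text \<open>As \<open>k\<close> inverts \<open>f\<close>, the points where |f| is at most 1 - e lie
  in a compact subset of \<Omega>. The image of the diameter keeps away from it, so the modulus of f
  o g tends to 1 there and reflection applies. Injectivity then spreads from the upper half-disc by
  openness to the diameter and by symmetry to the lower half.\<close>

lemma boundary_chart_disc_map_extends:
  fixes f k g :: "complex \<Rightarrow> complex"
  assumes ch: "boundary_chart \<Omega> p r g"
    and f: "f holomorphic_on \<Omega>" and k: "k holomorphic_on ball 0 1"
    and fk: "\<And>z. z \<in> \<Omega> \<Longrightarrow> f z \<in> ball 0 1 \<and> k (f z) = z" and kf: "\<And>w. w \<in> ball 0 1 \<Longrightarrow> k w \<in> \<Omega>"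
  obtains F r' where "0 < r'" "r' \<le> r" "F holomorphic_on ball 0 r'" "inj_on F (ball 0 r')"
    "\<And>z. \<lbrakk>z \<in> ball 0 r'; 0 < Im z\<rbrakk> \<Longrightarrow> F z = f (g z)"
    "\<And>z. z \<in> ball 0 r' \<Longrightarrow> F (cnj z) * cnj (F z) = 1"
    "\<And>z. z \<in> ball 0 r' \<Longrightarrow> norm (F z) < 1 \<longleftrightarrow> 0 < Im z"
proof -
  have r: "0 < r" and g: "g holomorphic_on ball 0 r" "inj_on g (ball 0 r)"
    and side: "\<And>z. z \<in> ball 0 r \<Longrightarrow> g z \<in> \<Omega> \<longleftrightarrow> 0 < Im z"
    using ch by (auto simp: boundary_chart_def)
  have proper: "\<exists>d>0. \<forall>z\<in>ball (of_real x) d. z \<in> ball 0 r \<and> 0 < Im z \<longrightarrow> 1 - e < norm (f (g z))"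
    if x: "\<bar>x\<bar> < r" and e: "0 < e" for x e :: real
  proof -
    define K where "K = k ` cball 0 (1 - e)"
    have sub: "cball 0 (1 - e) \<subseteq> ball (0::complex) 1" using e by auto
    have "compact K"
      unfolding K_def using k sub
      by (intro compact_continuous_image compact_cball) (meson continuous_on_subset holomorphic_on_imp_continuous_on)
    then have "open (- K)" by (simp add: compact_imp_closed open_Compl)
    then have "open (ball 0 r \<inter> g -` (- K))"
      by (intro continuous_open_preimage holomorphic_on_imp_continuous_on g open_ball)
    moreover have "K \<subseteq> \<Omega>" using kf sub by (auto simp: K_def)
    then have "of_real x \<in> ball 0 r \<inter> g -` (- K)" using side[of "of_real x"] x by auto
    ultimately obtain d where d: "0 < d" "ball (of_real x) d \<subseteq> ball 0 r \<inter> g -` (- K)" using openE by blast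
    have "1 - e < norm (f (g z))" if z: "z \<in> ball (of_real x) d" "z \<in> ball 0 r" "0 < Im z" for z
    proof (rule ccontr)
      assume "\<not> 1 - e < norm (f (g z))"
      then have "k (f (g z)) \<in> K" by (simp add: K_def)
      moreover have "k (f (g z)) = g z" using fk side z by blast
      ultimately show False using d z by auto
    qed
    then show ?thesis using d(1) by blast
  qed
  \<comment> \<open>The radius is shrunk until |f o g| exceeds 1/2: the lower bound required by the
    reflection.\<close>
  obtain d where d: "0 < d" "\<And>z. \<lbrakk>z \<in> ball 0 d; z \<in> ball 0 r; 0 < Im z\<rbrakk> \<Longrightarrow> 1/2 < norm (f (g z))"
    using proper[of 0 "1/2"] r by auto
  define r' where "r' = min r d"
  have r': "0 < r'" "r' \<le> r" using r d by (auto simp: r'_def)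
  have up: "f (g z) \<in> ball 0 1" if "z \<in> ball 0 r'" "0 < Im z" for z
    using that fk side[of z] r' by auto
  obtain F where F: "F holomorphic_on ball 0 r'"
    "\<And>z. \<lbrakk>z \<in> ball 0 r'; 0 < Im z\<rbrakk> \<Longrightarrow> F z = f (g z)"
    "\<And>z. z \<in> ball 0 r' \<Longrightarrow> F (cnj z) * cnj (F z) = 1"
  proof (rule unimodular_boundary_reflection[of r' "1/2" "\<lambda>z. f (g z)" 1])
    show "(\<lambda>z. f (g z)) holomorphic_on ball 0 r' \<inter> {z. 0 < Im z}"
      using holomorphic_on_compose_gen[of g "ball 0 r' \<inter> {z. 0 < Im z}" f \<Omega>] g f r' side
      by (fastforce simp: o_def intro: holomorphic_on_subset)
    show "1/2 \<le> norm (f (g z)) \<and> norm (f (g z)) \<le> 1" if "z \<in> ball 0 r'" "0 < Im z" for z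
      using up[OF that] d(2)[of z] that by (auto simp: r'_def)
    fix x :: real assume x: "x \<noteq> 0" "\<bar>x\<bar> < r'"
    show "((\<lambda>y. norm (f (g (Complex x y)))) \<longlongrightarrow> 1) (at_right 0)"
    proof (rule tendstoI)
      fix e :: real assume e: "0 < e"
      obtain d' where d': "0 < d'" "\<And>z. \<lbrakk>z \<in> ball (of_real x) d'; z \<in> ball 0 r; 0 < Im z\<rbrakk> \<Longrightarrow> 1 - e < norm (f (g z))"
        using proper[of x e] x r' e by auto
      show "\<forall>\<^sub>F y in at_right 0. dist (norm (f (g (Complex x y)))) 1 < e"
      proof (rule eventually_at_rightI[of 0 "min d' (r' - \<bar>x\<bar>)"])
        fix y assume y: "y \<in> {0<..<min d' (r' - \<bar>x\<bar>)}"
        have 1: "Complex x y \<in> ball 0 r'" using y cmod_le[of "Complex x y"] by auto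
        have "of_real x - Complex x y = - (\<i> * of_real y)" by (simp add: complex_eq_iff)
        then have 2: "Complex x y \<in> ball (of_real x) d'" using y by (simp add: dist_norm norm_mult)
        show "dist (norm (f (g (Complex x y)))) 1 < e"
          using up[OF 1] d'(2)[OF 2] 1 y r' by (auto simp: dist_real_def)
      qed (use x d' in auto)
    qed
  qed (use r' in auto)
  have lt: "norm (F z) < 1" if "z \<in> ball 0 r'" "0 < Im z" for z
    using up[OF that] F(2)[OF that] by simp
  have nF: "norm (F (cnj z)) * norm (F z) = 1" if "z \<in> ball 0 r'" for z
    using arg_cong[OF F(3)[OF that], of norm] by (simp add: norm_mult)
  have iff: "norm (F z) < 1 \<longleftrightarrow> 0 < Im z" if z: "z \<in> ball 0 r'" for z
  proof -
    have "\<not> norm (F z) < 1" if "Im z < 0"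
      using mult_strict_mono[OF lt[of "cnj z"] _ zero_less_one norm_ge_zero, of "F z" 1] nF[OF z] that z by auto
    moreover have "\<not> norm (F z) < 1" if "Im z = 0"
    proof -
      have "cnj z = z" using that by (simp add: complex_eq_iff)
      then have "norm (F z) * norm (F z) = 1" using nF[OF z] by simp
      then show ?thesis using mult_strict_mono[of "norm (F z)" 1 "norm (F z)" 1] by auto
    qed
    ultimately show ?thesis using lt[OF z] by force
  qed
  have inj_up: "z = w" if "z \<in> ball 0 r'" "w \<in> ball 0 r'" "0 < Im z" "0 < Im w" "F z = F w" for z w
  proof -
    have "k (f (g z)) = k (f (g w))" using that F(2) by simp
    then have "g z = g w" using that fk side r' by (metis mem_ball order_less_le_trans)
    then show ?thesis using g(2) that r' by (auto simp: inj_on_def)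
  qed
  \<comment> \<open>The open mapping theorem asks for this; two points of the imaginary axis witness
    it through \<open>inj_up\<close>.\<close>
  have nonconst: "\<not> F constant_on ball 0 r'"
  proof
    assume "F constant_on ball 0 r'"
    then obtain c where c: "F z = c" if "z \<in> ball 0 r'" for z unfolding constant_on_def by blast
    have in_r': "Complex 0 (r'/2) \<in> ball 0 r'" "Complex 0 (r'/3) \<in> ball 0 r'"
      using r' by (auto simp: complex_norm)
    have "Complex 0 (r'/2) = Complex 0 (r'/3)"
      by (rule inj_up) (use in_r' c[OF in_r'(1)] c[OF in_r'(2)] r' in auto)
    then show False using r' by simp
  qed
  \<comment> \<open>If two distinct points shared a value of modulus at most 1, then by openness
    points near them would share a value of modulus below 1. Such values are attained only in the
    upper half-disc, where \<open>F\<close> is injective.\<close>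
  have inj_le: "z = w" if zw: "z \<in> ball 0 r'" "w \<in> ball 0 r'" "F z = F w" "norm (F z) \<le> 1" for z w
  proof (rule ccontr)
    assume "z \<noteq> w"
    then obtain A B where AB: "open A" "open B" "z \<in> A" "w \<in> B" "A \<inter> B = {}" using hausdorff by metis
    have op: "open (F ` (A \<inter> ball 0 r'))" "open (F ` (B \<inter> ball 0 r'))"
      using AB by (auto intro!: open_mapping_thm[OF F(1) _ _ _ _ nonconst])
    define v where "v = F z"
    have "v \<in> F ` (A \<inter> ball 0 r')" unfolding v_def using AB zw by (intro imageI) simp
    moreover have "v \<in> F ` (B \<inter> ball 0 r')" unfolding v_def zw(3) using AB zw by (intro imageI) simp
    ultimately obtain e where e: "0 < e" "ball v e \<subseteq> F ` (A \<inter> ball 0 r') \<inter> F ` (B \<inter> ball 0 r')"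
      using openE[OF open_Int[OF op]] by blast
    \<comment> \<open>t < 1 keeps the factor 1 - t positive; t < e keeps the shrunken value in the
      ball, since it moves by at most t.\<close>
    define t where "t = min (1/2) (e/2)"
    have t: "0 < t" "t < 1" "t < e" using e by (auto simp: t_def)
    define v' where "v' = of_real (1 - t) * v"
    have "v - v' = of_real t * v" by (simp add: v'_def algebra_simps)
    then have "dist v v' = t * norm v" using t by (simp add: dist_norm norm_mult)
    also have "\<dots> \<le> t * 1" using t zw(4) by (intro mult_left_mono) (auto simp: v_def)
    also have "\<dots> < e" using t by simp
    finally have "v' \<in> ball v e" by simp
    then have "v' \<in> F ` (A \<inter> ball 0 r')" "v' \<in> F ` (B \<inter> ball 0 r')" using e by auto
    then obtain z' w' where z'w': "z' \<in> A" "z' \<in> ball 0 r'" "w' \<in> B" "w' \<in> ball 0 r'" "F z' = v'" "F w' = v'"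
      by (elim imageE) auto
    have "norm v' = (1 - t) * norm v" using t unfolding v'_def norm_mult norm_of_real by simp
    also have "\<dots> \<le> (1 - t) * 1" using t zw(4) by (intro mult_left_mono) (auto simp: v_def)
    also have "\<dots> < 1" using t by simp
    finally have "0 < Im z'" "0 < Im w'" using z'w' iff[of z'] iff[of w'] by auto
    then have "z' = w'" using z'w' by (intro inj_up[of z' w']) auto
    then show False using AB z'w' by blast
  qed
  have "inj_on F (ball 0 r')"
  proof (rule inj_onI)
    fix z w assume zw: "z \<in> ball 0 r'" "w \<in> ball 0 r'" "F z = F w"
    show "z = w"
    proof (cases "norm (F z) \<le> 1")
      case True
      then show ?thesis using inj_le zw by blast
    next
      \<comment> \<open>Values outside the closed unit disc are moved inside by the reflection,
        which reduces to \<open>inj_le\<close>.\<close>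
      case False
      have nz: "cnj (F z) \<noteq> 0" using False by auto
      have "F (cnj z) * cnj (F z) = F (cnj w) * cnj (F z)" using F(3)[OF zw(1)] F(3)[OF zw(2)] zw(3) by simp
      then have "F (cnj z) = F (cnj w)" using nz by simp
      moreover have "norm (F (cnj z)) \<le> 1"
      proof (rule ccontr)
        assume "\<not> norm (F (cnj z)) \<le> 1"
        then have "1 * 1 < norm (F (cnj z)) * norm (F z)" using False by (intro mult_strict_mono) auto
        then show False using nF[OF zw(1)] by simp
      qed
      ultimately have "cnj z = cnj w" using inj_le[of "cnj z" "cnj w"] zw by simp
      then show ?thesis by simp
    qed
  qed
  then show ?thesis using that r' F iff by blast
qed

section \<open>Conformal maps near a boundary point\<close>

definition cayley :: "complex \<Rightarrow> complex" where "cayley w = (w - \<i>) / (w + \<i>)"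

definition cayley_inv :: "complex \<Rightarrow> complex" where "cayley_inv v = \<i> * (1 + v) / (1 - v)"

text \<open>A point of the upper half-plane is nearer to i than to -i. The point -i itself must be
  excluded: division by zero gives \<open>cayley\<close> the value 0 there.\<close>

lemma norm_cayley_less_1_iff: "w \<noteq> - \<i> \<Longrightarrow> norm (cayley w) < 1 \<longleftrightarrow> 0 < Im w"
proof -
  assume "w \<noteq> - \<i>"
  then have "0 < norm (w + \<i>)" by (metis add_eq_0_iff2 norm_eq_zero norm_ge_zero order_less_le)
  then have "norm (cayley w) < 1 \<longleftrightarrow> (norm (w - \<i>))\<^sup>2 < (norm (w + \<i>))\<^sup>2"
    by (auto simp: cayley_def norm_divide intro: power_strict_mono dest: power2_less_imp_less)
  also have "\<dots> \<longleftrightarrow> 0 < Im w" unfolding cmod_power2 by (simp add: power2_eq_square algebra_simps)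
  finally show ?thesis .
qed

lemma cayley_inv_cayley: "w \<noteq> - \<i> \<Longrightarrow> cayley_inv (cayley w) = w"
proof -
  assume "w \<noteq> - \<i>"
  then have nz: "w + \<i> \<noteq> 0" by (simp add: add_eq_0_iff2)
  then have "1 + cayley w = 2 * w / (w + \<i>)" "1 - cayley w = 2 * \<i> / (w + \<i>)"
    by (simp_all add: cayley_def field_simps)
  then show ?thesis using nz by (simp add: cayley_inv_def)
qed

lemma cayley_cayley_inv: "v \<noteq> 1 \<Longrightarrow> cayley (cayley_inv v) = v"
  by (simp add: cayley_def cayley_inv_def field_simps)

lemma cayley_inv_ne: "v \<noteq> 1 \<Longrightarrow> cayley_inv v \<noteq> - \<i>"
  by (auto simp: cayley_inv_def field_simps)

lemma cayley_holomorphic: "- \<i> \<notin> S \<Longrightarrow> cayley holomorphic_on S"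
  unfolding cayley_def by (intro holomorphic_intros) (auto simp: add_eq_0_iff2)

lemma cayley_inv_holomorphic: "1 \<notin> S \<Longrightarrow> cayley_inv holomorphic_on S"
  unfolding cayley_inv_def by (intro holomorphic_intros) auto

lemma cayley_half_plane: "w \<in> upper_half_plane \<Longrightarrow> cayley w \<in> ball 0 1"
  by (subst mem_ball_0, subst norm_cayley_less_1_iff) (auto simp: upper_half_plane_def)

lemma cayley_inv_ball: "v \<in> ball 0 1 \<Longrightarrow> cayley_inv v \<in> upper_half_plane"
  by (cases "v = 1") (use norm_cayley_less_1_iff[OF cayley_inv_ne, of v] cayley_cayley_inv[of v] in
      \<open>auto simp: upper_half_plane_def\<close>)

text \<open>Conjugation corresponds to inversion in the unit circle. The reflected disc map
  satisfies the same functional equation, and this match makes the coordinate change \<eta> below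
  commute with conjugation.\<close>

lemma cayley_cnj: "\<lbrakk>w \<noteq> \<i>; w \<noteq> - \<i>\<rbrakk> \<Longrightarrow> cayley (cnj w) * cnj (cayley w) = 1"
proof -
  assume "w \<noteq> \<i>" "w \<noteq> - \<i>"
  then have "w - \<i> \<noteq> 0" "w + \<i> \<noteq> 0" by (auto simp: add_eq_0_iff2)
  then have "cnj (w - \<i>) \<noteq> 0" "cnj (w + \<i>) \<noteq> 0" unfolding complex_cnj_zero_iff by auto
  then show ?thesis by (simp add: cayley_def)
qed

text \<open>
  Near the boundary point, \<open>h = g \<circ> \<eta>\<close> for a conformal map \<open>\<eta>\<close> that commutes with conjugation:
  the Cayley transform followed by a branch of the inverse of the reflected map \<open>cayley \<circ> h\<^sup>-\<^sup>1 \<circ> g\<close>.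
\<close>
lemma conformal_map_in_boundary_chart:
  assumes ch: "boundary_chart \<Omega> p r g" and bih: "biholomorphic h upper_half_plane \<Omega>"
    and lim: "(h \<longlongrightarrow> p) (at 0 within upper_half_plane)"
  obtains \<eta> \<epsilon> where "0 < \<epsilon>" "\<eta> holomorphic_on ball 0 \<epsilon>" "inj_on \<eta> (ball 0 \<epsilon>)" "\<eta> 0 = 0"
    "\<eta> ` ball 0 \<epsilon> \<subseteq> ball 0 r" "\<And>w. w \<in> ball 0 \<epsilon> \<Longrightarrow> \<eta> (cnj w) = cnj (\<eta> w)"
    "\<And>w. \<lbrakk>w \<in> ball 0 \<epsilon>; 0 < Im w\<rbrakk> \<Longrightarrow> h w = g (\<eta> w)"
proof -
  let ?H = "upper_half_plane"
  define hi where "hi = inv_into ?H h"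
  have h: "h holomorphic_on ?H" "bij_betw h ?H \<Omega>" and hi: "hi holomorphic_on \<Omega>"
    using bih by (auto simp: biholomorphic_def hi_def)
  have hih: "hi (h w) = w" if "w \<in> ?H" for w
    using h(2) that by (auto simp: hi_def bij_betw_def)
  have hhi: "h (hi z) = z" "hi z \<in> ?H" if "z \<in> \<Omega>" for z
    using h(2) that by (auto simp: hi_def bij_betw_def f_inv_into_f inv_into_into)
  have hH: "h w \<in> \<Omega>" if "w \<in> ?H" for w using h(2) that by (auto simp: bij_betw_def)
  have niH: "- \<i> \<notin> ?H" by (simp add: upper_half_plane_def)
  have r: "0 < r" and g: "g holomorphic_on ball 0 r" "inj_on g (ball 0 r)" "g 0 = p"
    and side: "\<And>z. z \<in> ball 0 r \<Longrightarrow> g z \<in> \<Omega> \<longleftrightarrow> 0 < Im z"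
    using ch by (auto simp: boundary_chart_def)
  obtain F r' where r': "0 < r'" "r' \<le> r" and F: "F holomorphic_on ball 0 r'" "inj_on F (ball 0 r')"
    "\<And>z. \<lbrakk>z \<in> ball 0 r'; 0 < Im z\<rbrakk> \<Longrightarrow> F z = cayley (hi (g z))"
    "\<And>z. z \<in> ball 0 r' \<Longrightarrow> F (cnj z) * cnj (F z) = 1"
    "\<And>z. z \<in> ball 0 r' \<Longrightarrow> norm (F z) < 1 \<longleftrightarrow> 0 < Im z"
  proof (rule boundary_chart_disc_map_extends[OF ch, of "\<lambda>z. cayley (hi z)" "\<lambda>v. h (cayley_inv v)"])
    show "(\<lambda>z. cayley (hi z)) holomorphic_on \<Omega>"
      using holomorphic_on_compose_gen[OF hi cayley_holomorphic[OF niH]] hhi by (auto simp: o_def image_subset_iff)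
    show "(\<lambda>v. h (cayley_inv v)) holomorphic_on ball 0 1"
      using holomorphic_on_compose_gen[OF cayley_inv_holomorphic h(1), of "ball 0 1"] cayley_inv_ball
      by (auto simp: o_def image_subset_iff)
    show "cayley (hi z) \<in> ball 0 1 \<and> h (cayley_inv (cayley (hi z))) = z" if "z \<in> \<Omega>" for z
    proof -
      have "hi z \<noteq> - \<i>" using hhi(2)[OF that] niH by metis
      then show ?thesis using hhi[OF that] cayley_half_plane cayley_inv_cayley[of "hi z"] by simp
    qed
    show "h (cayley_inv w) \<in> \<Omega>" if "w \<in> ball 0 1" for w
      using cayley_inv_ball[OF that] hH by blast
  qed blast
  obtain Fi where Fi: "Fi holomorphic_on F ` ball 0 r'" "\<And>z. z \<in> ball 0 r' \<Longrightarrow> Fi (F z) = z"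
    using holomorphic_has_inverse[OF F(1) open_ball F(2)] by metis
  have opF: "open (F ` ball 0 r')" using open_mapping_thm3 F by blast
  have g': "g holomorphic_on ball 0 r'" "inj_on g (ball 0 r')"
    using g r' by (auto intro: holomorphic_on_subset inj_on_subset)
  obtain gi where gi: "gi holomorphic_on g ` ball 0 r'" "\<And>z. z \<in> ball 0 r' \<Longrightarrow> gi (g z) = z"
    using holomorphic_has_inverse[OF g'(1) open_ball g'(2)] by metis
  have opg: "open (g ` ball 0 r')" using open_mapping_thm3 g' by blast
  have pg: "p \<in> g ` ball 0 r'" using g(3) r'(1) by force
  \<comment> \<open>Here the normalization of \<open>h\<close> enters: as w tends to 0, the chart
    coordinate of h w tends to 0, so \<open>F\<close> there tends to F 0; but this value of
    \<open>F\<close> is cayley w, which tends to -1.\<close>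
  have F0: "F 0 = -1"
  proof -
    have nontriv: "at 0 within ?H \<noteq> bot"
    proof -
      have "0 islimpt ?H"
        unfolding islimpt_approachable
      proof (intro allI impI)
        fix e :: real assume "0 < e"
        then show "\<exists>x'\<in>?H. x' \<noteq> 0 \<and> dist x' 0 < e"
          by (intro bexI[of _ "\<i> * of_real (e/2)"]) (auto simp: upper_half_plane_def norm_mult)
      qed
      then show ?thesis by (simp add: trivial_limit_within)
    qed
    have ev: "\<forall>\<^sub>F w in at 0 within ?H. h w \<in> g ` ball 0 r' \<and> w \<in> ?H"
      using topological_tendstoD[OF lim opg pg] eventually_at_topological by (auto intro!: eventually_conj simp: eventually_at_filter)
    have "isCont gi p"
      using gi(1) opg pg holomorphic_on_imp_continuous_on continuous_on_eq_continuous_at by blast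
    then have "((\<lambda>w. gi (h w)) \<longlongrightarrow> gi p) (at 0 within ?H)"
      using lim by (rule isCont_tendsto_compose)
    moreover have "gi p = 0" using gi(2)[of 0] g(3) r'(1) by simp
    moreover have "isCont F 0"
      using F(1) r'(1) holomorphic_on_imp_continuous_on continuous_on_eq_continuous_at[OF open_ball] by force
    ultimately have 1: "((\<lambda>w. F (gi (h w))) \<longlongrightarrow> F 0) (at 0 within ?H)"
      by (metis isCont_tendsto_compose)
    have "\<forall>\<^sub>F w in at 0 within ?H. F (gi (h w)) = cayley w"
      using ev
    proof eventually_elim
      case (elim w)
      then obtain z where z: "z \<in> ball 0 r'" "h w = g z" by blast
      have "g z \<in> \<Omega>" using elim hH z by metis
      then have "0 < Im z" using side z r' by auto
      then show ?case using F(3)[OF z(1)] gi(2)[OF z(1)] z hih elim by metis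
    qed
    from Lim_transform_eventually[OF 1 this] have "(cayley \<longlongrightarrow> F 0) (at 0 within ?H)" .
    moreover have "(cayley \<longlongrightarrow> (0 - \<i>) / (0 + \<i>)) (at 0 within ?H)"
      unfolding cayley_def[abs_def] by (intro tendsto_intros) auto
    ultimately show ?thesis using tendsto_unique[OF nontriv] by fastforce
  qed
  have "- 1 \<in> F ` ball 0 r'" using F0 r'(1) by (intro image_eqI[of _ _ 0]) auto
  moreover have "cayley 0 = -1" by (simp add: cayley_def)
  moreover have "continuous_on (ball 0 1) cayley"
    by (intro holomorphic_on_imp_continuous_on cayley_holomorphic) auto
  ultimately have "open (ball 0 1 \<inter> cayley -` (F ` ball 0 r'))" "0 \<in> ball 0 1 \<inter> cayley -` (F ` ball 0 r')"
    using opF by (auto intro: continuous_open_preimage)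
  \<comment> \<open>Staying inside the unit disc avoids the pole -i of \<open>cayley\<close> and its
    zero i, where the reflection identity fails.\<close>
  then obtain \<epsilon> where \<epsilon>: "0 < \<epsilon>" "ball 0 \<epsilon> \<subseteq> ball 0 1 \<inter> cayley -` (F ` ball 0 r')" using openE by blast
  have ne: "w \<noteq> - \<i>" "w \<noteq> \<i>" if "w \<in> ball 0 \<epsilon>" for w
    using that \<epsilon>(2) by (auto simp: subset_iff)
  define \<eta> where "\<eta> w = Fi (cayley w)" for w
  have \<eta>: "\<eta> w \<in> ball 0 r'" "F (\<eta> w) = cayley w" if "w \<in> ball 0 \<epsilon>" for w
  proof -
    have "cayley w \<in> F ` ball 0 r'" using \<epsilon>(2) that by blast
    then obtain z where "z \<in> ball 0 r'" "cayley w = F z" by blast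
    then show "\<eta> w \<in> ball 0 r'" "F (\<eta> w) = cayley w" using Fi(2) by (auto simp: \<eta>_def)
  qed
  show ?thesis
  proof (rule that[of \<epsilon> \<eta>])
    have "cayley holomorphic_on ball 0 \<epsilon>" using ne by (intro cayley_holomorphic) blast
    moreover have "cayley ` ball 0 \<epsilon> \<subseteq> F ` ball 0 r'" using \<epsilon>(2) by blast
    ultimately show "\<eta> holomorphic_on ball 0 \<epsilon>"
      using holomorphic_on_compose_gen[OF _ Fi(1)] by (auto simp: \<eta>_def[abs_def] o_def)
    show "inj_on \<eta> (ball 0 \<epsilon>)"
      by (rule inj_onI) (metis \<eta>(2) cayley_inv_cayley ne(1))
    show "\<eta> 0 = 0" using Fi(2)[of 0] F0 r'(1) by (simp add: \<eta>_def cayley_def)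
    show "\<eta> ` ball 0 \<epsilon> \<subseteq> ball 0 r" using \<eta>(1) r'(2) by force
    show "\<eta> (cnj w) = cnj (\<eta> w)" if w: "w \<in> ball 0 \<epsilon>" for w
    proof -
      have cw: "cnj w \<in> ball 0 \<epsilon>" using w by simp
      have nz: "cnj (cayley w) \<noteq> 0" using cayley_cnj[OF ne(2,1)[OF w]] by (metis mult_zero_right zero_neq_one)
      \<comment> \<open>Both values of \<open>F\<close> are the inverse of cnj (cayley w), by the
        two reflection identities.\<close>
      have "F (cnj (\<eta> w)) * cnj (cayley w) = F (\<eta> (cnj w)) * cnj (cayley w)"
        using F(4)[OF \<eta>(1)[OF w]] cayley_cnj[OF ne(2,1)[OF w]] \<eta>(2)[OF w] \<eta>(2)[OF cw] by metis
      then have "F (cnj (\<eta> w)) = F (\<eta> (cnj w))" using nz by simp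
      then show ?thesis using F(2) \<eta>(1)[OF w] \<eta>(1)[OF cw] by (auto simp: inj_on_def)
    qed
    show "h w = g (\<eta> w)" if w: "w \<in> ball 0 \<epsilon>" "0 < Im w" for w
    proof -
      have "norm (F (\<eta> w)) < 1" using norm_cayley_less_1_iff[OF ne(1)] \<eta>(2) w by simp
      then have im: "0 < Im (\<eta> w)" using F(5) \<eta>(1) w by blast
      then have \<Omega>: "g (\<eta> w) \<in> \<Omega>" using side \<eta>(1)[OF w(1)] r' by auto
      have "cayley (hi (g (\<eta> w))) = cayley w" using F(3) \<eta> im w by metis
      then have "hi (g (\<eta> w)) = w"
        using cayley_inv_cayley ne(1)[OF w(1)] hhi(2)[OF \<Omega>] niH by metis
      then show ?thesis using hhi(1)[OF \<Omega>] by simp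
    qed
  qed (rule \<epsilon>(1))
qed

text \<open>A Riemann map read in the chart extends across the boundary point with a unimodular
  value \<open>F 0\<close>. A rotation of the disc matches this value with -1 = cayley 0, so the
  limit is obtained without a global boundary extension.\<close>

lemma conformal_map_to_boundary_point_exists:
  assumes ch: "boundary_chart \<Omega> p r g" and \<Omega>: "open \<Omega>" "simply_connected \<Omega>" "\<Omega> \<noteq> UNIV" "\<Omega> \<noteq> {}"
  obtains h where "biholomorphic h upper_half_plane \<Omega>" "(h \<longlongrightarrow> p) (at 0 within upper_half_plane)"
proof -
  let ?H = "upper_half_plane"
  have "open \<Omega> \<and> simply_connected \<Omega>" using \<Omega> by simp
  from this[unfolded Riemann_mapping_theorem] \<Omega>(3,4)
  obtain f k where f: "f holomorphic_on \<Omega>" and k: "k holomorphic_on ball 0 1"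
    and fk: "\<And>z. z \<in> \<Omega> \<Longrightarrow> f z \<in> ball 0 1 \<and> k (f z) = z"
    and kf: "\<And>w. w \<in> ball 0 1 \<Longrightarrow> k w \<in> \<Omega> \<and> f (k w) = w"
    by blast
  obtain F r' where r': "0 < r'" "r' \<le> r" and F: "F holomorphic_on ball 0 r'" "inj_on F (ball 0 r')"
    "\<And>z. \<lbrakk>z \<in> ball 0 r'; 0 < Im z\<rbrakk> \<Longrightarrow> F z = f (g z)"
    "\<And>z. z \<in> ball 0 r' \<Longrightarrow> F (cnj z) * cnj (F z) = 1"
    "\<And>z. z \<in> ball 0 r' \<Longrightarrow> norm (F z) < 1 \<longleftrightarrow> 0 < Im z"
    by (rule boundary_chart_disc_map_extends[OF ch f k], erule fk, erule kf[THEN conjunct1], rule that; assumption)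
  have g: "g holomorphic_on ball 0 r" "g 0 = p"
    and side: "\<And>z. z \<in> ball 0 r \<Longrightarrow> g z \<in> \<Omega> \<longleftrightarrow> 0 < Im z"
    using ch by (auto simp: boundary_chart_def)
  obtain Fi where Fi: "Fi holomorphic_on F ` ball 0 r'" "\<And>z. z \<in> ball 0 r' \<Longrightarrow> Fi (F z) = z"
    using holomorphic_has_inverse[OF F(1) open_ball F(2)] by metis
  have opF: "open (F ` ball 0 r')" using open_mapping_thm3 F by blast
  \<comment> \<open>Chosen so that v times cayley 0 is F 0.\<close>
  define v where "v = - F 0"
  have "F 0 * cnj (F 0) = 1" using F(4)[of 0] r'(1) by simp
  then have vv: "v * cnj v = 1" by (simp add: v_def)
  have nv: "norm v = 1"
    using vv by (metis complex_mod_cnj norm_mult norm_one norm_ge_zero power2_eq_1_iff power2_eq_square abs_norm_cancel abs_1 power2_eq_iff_nonneg zero_le_one)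
  define h where "h w = k (v * cayley w)" for w
  have vc: "v * cayley w \<in> ball 0 1" if "w \<in> ?H" for w
    using cayley_half_plane[OF that] nv by (simp add: norm_mult)
  have niH: "- \<i> \<notin> ?H" by (simp add: upper_half_plane_def)
  define hi where "hi z = cayley_inv (cnj v * f z)" for z
  have vf: "cnj v * f z \<in> ball 0 1" if "z \<in> \<Omega>" for z using fk[OF that] nv by (simp add: norm_mult)
  have hih: "hi (h w) = w" if "w \<in> ?H" for w
  proof -
    have "f (h w) = v * cayley w" using kf[OF vc[OF that]] by (simp add: h_def)
    then have "cnj v * f (h w) = (v * cnj v) * cayley w" by simp
    then show ?thesis using cayley_inv_cayley[of w] that niH vv by (auto simp: hi_def)
  qed
  have hhi: "h (hi z) = z" if "z \<in> \<Omega>" for z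
  proof -
    have "cayley (hi z) = cnj v * f z" using vf[OF that] unfolding hi_def by (intro cayley_cayley_inv) auto
    then have "v * cayley (hi z) = (v * cnj v) * f z" by simp
    then show ?thesis using fk[OF that] vv by (simp add: h_def)
  qed
  have hH: "h w \<in> \<Omega>" if "w \<in> ?H" for w using kf[OF vc[OF that]] by (simp add: h_def)
  have hiH: "hi z \<in> ?H" if "z \<in> \<Omega>" for z using cayley_inv_ball[OF vf[OF that]] by (simp add: hi_def)
  have bij: "bij_betw h ?H \<Omega>"
    by (rule bij_betw_byWitness[of _ hi]) (use hih hhi hH hiH in auto)
  have "biholomorphic h ?H \<Omega>"
    unfolding biholomorphic_def
  proof (intro conjI bij)
    have "(\<lambda>w. v * cayley w) holomorphic_on ?H" by (intro holomorphic_intros cayley_holomorphic niH)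
    from holomorphic_on_compose_gen[OF this k] show "h holomorphic_on ?H"
      using vc by (auto simp: h_def[abs_def] o_def image_subset_iff)
    have "(\<lambda>z. cnj v * f z) holomorphic_on \<Omega>" by (intro holomorphic_intros f)
    from holomorphic_on_compose_gen[OF this cayley_inv_holomorphic[of "ball 0 1"]] have "hi holomorphic_on \<Omega>"
      using vf by (auto simp: hi_def[abs_def] o_def image_subset_iff)
    then show "inv_into ?H h holomorphic_on \<Omega>"
      by (rule holomorphic_transform) (metis bij bij_betw_inv_into_left hhi hiH)
  qed
  moreover have "(h \<longlongrightarrow> p) (at 0 within ?H)"
  proof -
    have "(cayley \<longlongrightarrow> (0 - \<i>) / (0 + \<i>)) (at 0 within ?H)"
      unfolding cayley_def[abs_def] by (intro tendsto_intros) auto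
    from tendsto_mult_left[OF this, of v] have lim: "((\<lambda>w. v * cayley w) \<longlongrightarrow> F 0) (at 0 within ?H)"
      by (simp add: v_def)
    have F0: "F 0 \<in> F ` ball 0 r'" using r'(1) by auto
    have "isCont Fi (F 0)"
      using Fi(1) opF F0 holomorphic_on_imp_continuous_on continuous_on_eq_continuous_at by blast
    then have "((\<lambda>w. Fi (v * cayley w)) \<longlongrightarrow> Fi (F 0)) (at 0 within ?H)"
      using lim by (rule isCont_tendsto_compose)
    moreover have "Fi (F 0) = 0" using Fi(2) r'(1) by simp
    moreover have "isCont g 0"
      using g(1) r' holomorphic_on_imp_continuous_on continuous_on_eq_continuous_at[OF open_ball] by force
    ultimately have 1: "((\<lambda>w. g (Fi (v * cayley w))) \<longlongrightarrow> p) (at 0 within ?H)"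
      using g(2) by (metis isCont_tendsto_compose)
    \<comment> \<open>For w near 0 in the half-plane, v cayley w has an \<open>F\<close>-preimage in
      the upper half-disc, where \<open>F\<close> is f o g; so \<open>h\<close> is there g o Fi
      applied to v cayley w.\<close>
    have "\<forall>\<^sub>F w in at 0 within ?H. v * cayley w \<in> F ` ball 0 r' \<and> w \<in> ?H"
      using topological_tendstoD[OF lim opF F0] by (auto intro!: eventually_conj simp: eventually_at_filter)
    then have "\<forall>\<^sub>F w in at 0 within ?H. g (Fi (v * cayley w)) = h w"
    proof eventually_elim
      case (elim w)
      then obtain z where z: "z \<in> ball 0 r'" "v * cayley w = F z" by blast
      have "norm (F z) < 1" using vc[of w] elim z by simp
      then have im: "0 < Im z" using F(5) z by blast
      then have "F z = f (g z)" "g z \<in> \<Omega>" using F(3) z side r' by auto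
      then show ?case using fk Fi(2)[OF z(1)] z(2) by (simp add: h_def)
    qed
    from Lim_transform_eventually[OF 1 this] show ?thesis .
  qed
  ultimately show ?thesis using that by blast
qed

section \<open>The height function and the extension\<close>

text \<open>
  Subtracting the harmonic function \<open>A + (B - A) \<theta> / \<pi>\<close> with the same boundary values leaves
  boundary values \<open>0\<close> off the origin; exponentiating a holomorphic function with that real part
  turns the odd reflection into the reflection in the unit circle.
\<close>
lemma half_disc_step_boundary_values:
  fixes Q :: "complex \<Rightarrow> complex" and \<epsilon> M A B :: real
  assumes \<epsilon>: "0 < \<epsilon>" and Q: "Q holomorphic_on ball 0 \<epsilon> \<inter> {w. 0 < Im w}"
    and M: "\<And>w. \<lbrakk>w \<in> ball 0 \<epsilon>; 0 < Im w\<rbrakk> \<Longrightarrow> \<bar>Re (Q w)\<bar> \<le> M"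
    and A: "\<And>x. \<lbrakk>0 < x; x < \<epsilon>\<rbrakk> \<Longrightarrow> ((\<lambda>y. Re (Q (Complex x y))) \<longlongrightarrow> A) (at_right 0)"
    and B: "\<And>x. \<lbrakk>x < 0; - \<epsilon> < x\<rbrakk> \<Longrightarrow> ((\<lambda>y. Re (Q (Complex x y))) \<longlongrightarrow> B) (at_right 0)"
  obtains L where "L holomorphic_on ball 0 \<epsilon>" "\<And>z. z \<in> ball 0 \<epsilon> \<Longrightarrow> Re (L (cnj z)) = - Re (L z)"
    "\<And>\<rho> \<theta>. \<lbrakk>0 < \<rho>; \<rho> < \<epsilon>; 0 < \<theta>; \<theta> < pi\<rbrakk> \<Longrightarrow>
       Re (Q (rcis \<rho> \<theta>)) = A + (B - A) * \<theta> / pi + Re (L (rcis \<rho> \<theta>))"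
proof -
  let ?D = "ball 0 \<epsilon> \<inter> {w. 0 < Im w}"
  define c where "c = (B - A) / pi"
  \<comment> \<open>The factor -i turns the upper into the right half-plane, away from the cut of
    \<open>Ln\<close>. If w has angle \<theta>, then Arg (-i w) = \<theta> - pi/2, so the last two
    terms together contribute -c \<theta> to the real part.\<close>
  define E where "E w = Q w - of_real A + \<i> * of_real c * Ln (- \<i> * w) - of_real (c * pi / 2)" for w
  have ReE: "Re (E w) = Re (Q w) - A - c * (Arg (- \<i> * w) + pi / 2)" if "w \<noteq> 0" for w
    using that Arg_eq_Im_Ln[of "- \<i> * w"] by (simp add: E_def algebra_simps)
  have E: "E holomorphic_on ?D"
    unfolding E_def by (intro holomorphic_intros Q) (auto simp: complex_nonpos_Reals_iff)
  define K where "K = M + \<bar>A\<bar> + \<bar>c\<bar> * (2 * pi)"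
  have bound: "\<bar>Re (E w)\<bar> \<le> K" if w: "w \<in> ball 0 \<epsilon>" "0 < Im w" for w
  proof -
    have "w \<noteq> 0" using w by auto
    have "\<bar>Arg (- \<i> * w) + pi / 2\<bar> \<le> 2 * pi"
      using mpi_less_Arg[of "- \<i> * w"] Arg_le_pi[of "- \<i> * w"] pi_gt_zero by linarith
    then have "\<bar>c * (Arg (- \<i> * w) + pi / 2)\<bar> \<le> \<bar>c\<bar> * (2 * pi)"
      unfolding abs_mult by (intro mult_left_mono) auto
    then show ?thesis unfolding ReE[OF \<open>w \<noteq> 0\<close>] K_def using M[OF w] by linarith
  qed
  have limE: "((\<lambda>y. Re (E (Complex x y))) \<longlongrightarrow> 0) (at_right 0)" if x: "x \<noteq> 0" "\<bar>x\<bar> < \<epsilon>" for x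
  proof -
    have lim: "((\<lambda>y. - \<i> * Complex x y) \<longlongrightarrow> - \<i> * Complex x 0) (at_right 0)"
      by (intro tendsto_intros)
    have np: "- \<i> * Complex x 0 \<notin> \<real>\<^sub>\<le>\<^sub>0" using x by (auto simp: complex_nonpos_Reals_iff)
    have "((\<lambda>y. Arg (- \<i> * Complex x y)) \<longlongrightarrow> Arg (- \<i> * Complex x 0)) (at_right 0)"
      by (rule isCont_tendsto_compose[OF _ lim]) (rule continuous_at_Arg[OF np])
    \<comment> \<open>The two half-axes get arguments -pi/2 and pi/2, so with c = (B - A) / pi the
      subtracted function equals A on the right and B on the left.\<close>
    moreover have "Arg (- \<i> * Complex x 0) = (if 0 < x then - pi / 2 else pi / 2)"
    proof -
      have "- \<i> * Complex x 0 = of_real \<bar>x\<bar> * (if 0 < x then - \<i> else \<i>)"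
        using x by (auto simp: complex_eq_iff)
      then show ?thesis using x by (simp add: Arg_times_of_real)
    qed
    moreover have "((\<lambda>y. Re (Q (Complex x y))) \<longlongrightarrow> (if 0 < x then A else B)) (at_right 0)"
      using A[of x] B[of x] x by auto
    ultimately have "((\<lambda>y. Re (Q (Complex x y)) - A - c * (Arg (- \<i> * Complex x y) + pi / 2)) \<longlongrightarrow>
        (if 0 < x then A else B) - A - c * ((if 0 < x then - pi / 2 else pi / 2) + pi / 2)) (at_right 0)"
      by (intro tendsto_intros) auto
    moreover have "(if 0 < x then A else B) - A - c * ((if 0 < x then - pi / 2 else pi / 2) + pi / 2) = 0"
      by (simp add: c_def)
    moreover have "Re (E (Complex x y)) = Re (Q (Complex x y)) - A - c * (Arg (- \<i> * Complex x y) + pi / 2)" for y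
      using x by (intro ReE) (simp add: complex_eq_iff)
    ultimately show ?thesis by simp
  qed
  obtain F where F: "F holomorphic_on ball 0 \<epsilon>"
    "\<And>z. \<lbrakk>z \<in> ball 0 \<epsilon>; 0 < Im z\<rbrakk> \<Longrightarrow> F z = exp (E z)"
    "\<And>z. z \<in> ball 0 \<epsilon> \<Longrightarrow> F (cnj z) * cnj (F z) = 1"
  proof (rule unimodular_boundary_reflection[of \<epsilon> "exp (- K)" "\<lambda>z. exp (E z)" "exp K"])
    show "(\<lambda>z. exp (E z)) holomorphic_on ?D" by (intro holomorphic_intros E)
    show "exp (- K) \<le> norm (exp (E z)) \<and> norm (exp (E z)) \<le> exp K" if "z \<in> ball 0 \<epsilon>" "0 < Im z" for z
      using bound[OF that] by auto
    show "((\<lambda>y. norm (exp (E (Complex x y)))) \<longlongrightarrow> 1) (at_right 0)" if "x \<noteq> 0" "\<bar>x\<bar> < \<epsilon>" for x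
      using tendsto_exp[OF limE[OF that]] by simp
  qed (use \<epsilon> in auto)
  \<comment> \<open>The reflection identity excludes zeros, so a logarithm exists on the whole disc.
    It may differ from \<open>E\<close> by a multiple of 2 pi i, which real parts do not
    see.\<close>
  have "F z \<noteq> 0" if "z \<in> ball 0 \<epsilon>" for z using F(3)[OF that] by auto
  then obtain L where L: "L holomorphic_on ball 0 \<epsilon>" "\<And>z. z \<in> ball 0 \<epsilon> \<Longrightarrow> F z = exp (L z)"
    using contractible_imp_holomorphic_log[OF F(1) convex_imp_contractible[OF convex_ball]] by metis
  show ?thesis
  proof (rule that[OF L(1)])
    show "Re (L (cnj z)) = - Re (L z)" if z: "z \<in> ball 0 \<epsilon>" for z
    proof -
      have "exp (L (cnj z)) * cnj (exp (L z)) = 1" using F(3)[OF z] L(2)[of z] L(2)[of "cnj z"] z by simp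
      from arg_cong[OF this, of norm] have "exp (Re (L (cnj z)) + Re (L z)) = 1"
        by (simp add: norm_mult exp_add)
      then show ?thesis by simp
    qed
    fix \<rho> \<theta> :: real assume \<rho>: "0 < \<rho>" "\<rho> < \<epsilon>" and \<theta>: "0 < \<theta>" "\<theta> < pi"
    define w where "w = rcis \<rho> \<theta>"
    have w: "w \<in> ball 0 \<epsilon>" "0 < Im w"
      using \<rho> \<theta> by (auto simp: w_def sin_gt_zero)
    then have "w \<noteq> 0" by auto
    have "exp (L w) = exp (E w)" using F(2) L(2) w by metis
    from arg_cong[OF this, of norm] have "Re (L w) = Re (E w)" by simp
    moreover have "Arg (- \<i> * w) = \<theta> - pi / 2"
    proof -
      have "- \<i> * w = rcis \<rho> (\<theta> - pi / 2)"
        by (simp add: w_def complex_eq_iff sin_diff cos_diff)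
      then show ?thesis using \<rho> \<theta> by (simp only:, intro Arg_rcis) auto
    qed
    ultimately show "Re (Q (rcis \<rho> \<theta>)) = A + (B - A) * \<theta> / pi + Re (L (rcis \<rho> \<theta>))"
      using ReE[OF \<open>w \<noteq> 0\<close>] by (simp add: w_def c_def)
  qed
qed

text \<open>Compactness: the points of the closed graph with height at least e away from t project
  to a compact set that misses p, since a point over p would be a boundary point of another height.
  This turns the description of the boundary set into boundary values of \<phi>.\<close>

lemma graph_over_boundary_limit:
  assumes "bounded (graph_over \<Omega> \<phi>)" "p \<notin> \<Omega>"
    and uniq: "\<And>s. (p, s) \<in> surface_boundary (graph_over \<Omega> \<phi>) \<Longrightarrow> s = t"
  shows "(\<phi> \<longlongrightarrow> t) (at p within \<Omega>)"
proof (rule tendstoI)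
  fix e :: real assume e: "0 < e"
  define C where "C = closure (graph_over \<Omega> \<phi>) \<inter> {q. e \<le> dist (snd q) t}"
  have "closed {q :: complex \<times> real. e \<le> dist (snd q) t}"
    by (intro closed_Collect_le continuous_intros)
  then have "compact C" using assms(1) by (auto simp: C_def intro!: compact_Int_closed)
  then have "compact (fst ` C)" by (intro compact_continuous_image continuous_intros)
  then have "open (- (fst ` C))" by (simp add: compact_imp_closed open_Compl)
  moreover have "p \<notin> fst ` C"
  proof
    assume "p \<in> fst ` C"
    then obtain s where s: "(p, s) \<in> closure (graph_over \<Omega> \<phi>)" "e \<le> dist s t" by (auto simp: C_def)
    moreover have "(p, s) \<notin> graph_over \<Omega> \<phi>" using assms(2) by (simp add: graph_over_def)
    ultimately show False using uniq[of s] e by (simp add: surface_boundary_def)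
  qed
  ultimately have "\<forall>\<^sub>F z in at p within \<Omega>. z \<in> - (fst ` C) \<and> z \<in> \<Omega>"
    by (auto simp: eventually_at_topological)
  then show "\<forall>\<^sub>F z in at p within \<Omega>. dist (\<phi> z) t < e"
  proof eventually_elim
    case (elim z)
    then have "(z, \<phi> z) \<in> closure (graph_over \<Omega> \<phi>)"
      using closure_subset by (fastforce simp: graph_over_def)
    then show ?case using elim by (force simp: C_def)
  qed
qed

lemma rcis_polar_swap: "rcis (- r) (pi - \<theta>) = cnj (rcis r \<theta>)"
  by (simp add: complex_eq_iff)

lemma affine_image_open_segment:
  fixes A B :: real
  assumes "A \<noteq> B"
  shows "(\<lambda>\<theta>. A + (B - A) * \<theta> / pi) ` {0<..<pi} = {min A B..max A B} - {A, B}"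
proof -
  have "(\<lambda>\<theta>. A + (B - A) * \<theta> / pi) ` {0<..<pi} = (\<lambda>\<theta>. (B - A) / pi * \<theta> + A) ` {0<..<pi}"
    by (simp add: add.commute)
  also have "\<dots> = {min A B<..<max A B}"
  proof (intro equalityI subsetI)
    fix t assume "t \<in> (\<lambda>\<theta>. (B - A) / pi * \<theta> + A) ` {0<..<pi}"
    then obtain \<theta> where \<theta>: "0 < \<theta>" "\<theta> < pi" "t = (B - A) / pi * \<theta> + A" by auto
    define q where "q = \<theta> / pi"
    have q: "0 < q" "q < 1" "t = A + (B - A) * q" using \<theta> by (auto simp: q_def)
    have "0 < (B - A) * q \<and> (B - A) * q < B - A \<or> (B - A) * q < 0 \<and> B - A < (B - A) * q"
      using q(1,2) assms by (cases "A < B") (auto simp: mult_pos_pos mult_neg_pos mult_less_cancel_left1 mult_less_cancel_left2)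
    then show "t \<in> {min A B<..<max A B}" using q(3) by auto
  next
    fix t assume t: "t \<in> {min A B<..<max A B}"
    define q where "q = (t - A) / (B - A)"
    have q: "0 < q" "q < 1" using t assms by (auto simp: q_def min_def max_def divide_simps split: if_splits)
    have "t = (B - A) / pi * (q * pi) + A" using assms by (simp add: q_def)
    then show "t \<in> (\<lambda>\<theta>. (B - A) / pi * \<theta> + A) ` {0<..<pi}"
      using q by (intro image_eqI[of _ _ "q * pi"]) auto
  qed
  finally show ?thesis by auto
qed

text \<open>Monotonicity of continuous injections on an interval. It shows that each half of the
  real axis goes to a single side of the arc, so that the height has one constant boundary value on
  each half.\<close>

lemma inj_continuous_separates_sides:
  fixes \<tau> :: "real \<Rightarrow> real"
  assumes "0 < \<epsilon>" "continuous_on {- \<epsilon><..<\<epsilon>} \<tau>" "inj_on \<tau> {- \<epsilon><..<\<epsilon>}"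
  shows "(\<forall>x. 0 < x \<and> x < \<epsilon> \<longrightarrow> \<tau> 0 < \<tau> x) \<and> (\<forall>x. - \<epsilon> < x \<and> x < 0 \<longrightarrow> \<tau> x < \<tau> 0) \<or>
         (\<forall>x. 0 < x \<and> x < \<epsilon> \<longrightarrow> \<tau> x < \<tau> 0) \<and> (\<forall>x. - \<epsilon> < x \<and> x < 0 \<longrightarrow> \<tau> 0 < \<tau> x)"
proof -
  have "\<tau> y < \<tau> 0 \<and> \<tau> 0 < \<tau> x \<or> \<tau> x < \<tau> 0 \<and> \<tau> 0 < \<tau> y" if "- \<epsilon> < y" "y < 0" "0 < x" "x < \<epsilon>" for x y
    by (rule continuous_inj_imp_mono)
      (use that in \<open>auto intro: continuous_on_subset[OF assms(2)] inj_on_subset[OF assms(3)]\<close>)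
  note * = this
  \<comment> \<open>Comparing every point with the references \<epsilon>/2 and -\<epsilon>/2 makes
    the alternative the same for all of them.\<close>
  have e: "- \<epsilon> < - (\<epsilon>/2)" "- (\<epsilon>/2) < 0" "0 < \<epsilon>/2" "\<epsilon>/2 < \<epsilon>" using \<open>0 < \<epsilon>\<close> by auto
  show ?thesis
    using *[OF e] *[OF e(1,2)] *[OF _ _ e(3,4)] by (smt (verit))
qed

text \<open>The chart \<open>g\<close> is tied to the reflection \<open>R\<close>, whereas \<gamma>
  records which side of p carries which height. \<open>polar_swap\<close> conjugates the point r
  e^(i \<theta>), so equivariance follows from the symmetry of \<eta>, the oddness of Re L and A + B
  = 2 m.\<close>

lemma extends_across_via_chart:
  fixes \<Omega> W :: "complex set" and \<phi> :: "complex \<Rightarrow> real" and g R h :: "complex \<Rightarrow> complex"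
    and \<gamma> :: "real \<Rightarrow> complex" and I :: "real set"
  assumes ch: "boundary_chart \<Omega> p r g"
    and bih: "biholomorphic h upper_half_plane \<Omega>" and lim: "(h \<longlongrightarrow> p) (at 0 within upper_half_plane)"
    and \<Omega>: "open \<Omega>" "simply_connected \<Omega>" and \<phi>: "harmonic_on \<phi> \<Omega>" "bounded (\<phi> ` \<Omega>)"
    and W: "\<And>z. z \<in> ball 0 r \<Longrightarrow> g z \<in> W" and R: "\<And>z. z \<in> ball 0 r \<Longrightarrow> R (g z) = g (cnj z)"
    and \<gamma>: "inj_on \<gamma> I" "continuous_on (\<gamma> ` I) (inv_into I \<gamma>)" "s \<in> I" "\<gamma> s = p"
    and arc: "\<And>x. \<bar>x\<bar> < r \<Longrightarrow> g (of_real x) \<in> \<gamma> ` I"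
    and a: "\<And>x. \<lbrakk>x \<in> I; x < s\<rbrakk> \<Longrightarrow> (\<phi> \<longlongrightarrow> a) (at (\<gamma> x) within \<Omega>)"
    and b: "\<And>x. \<lbrakk>x \<in> I; s < x\<rbrakk> \<Longrightarrow> (\<phi> \<longlongrightarrow> b) (at (\<gamma> x) within \<Omega>)"
    and ab: "a \<noteq> b" "m = (a + b) / 2"
  shows "extends_across_via (\<lambda>w. (h w, \<phi> (h w))) (isotropic_segment p a b - {(p, a), (p, b)})
           (W \<times> UNIV) (\<lambda>(z, t). (R z, 2 * m - t))"
proof -
  have g: "g holomorphic_on ball 0 r" "inj_on g (ball 0 r)" "g 0 = p"
    and side: "\<And>z. z \<in> ball 0 r \<Longrightarrow> g z \<in> \<Omega> \<longleftrightarrow> 0 < Im z"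
    using ch by (auto simp: boundary_chart_def)
  obtain \<eta> \<epsilon> where \<epsilon>: "0 < \<epsilon>" and \<eta>: "\<eta> holomorphic_on ball 0 \<epsilon>" "inj_on \<eta> (ball 0 \<epsilon>)" "\<eta> 0 = 0"
    "\<eta> ` ball 0 \<epsilon> \<subseteq> ball 0 r" "\<And>w. w \<in> ball 0 \<epsilon> \<Longrightarrow> \<eta> (cnj w) = cnj (\<eta> w)"
    and h\<eta>: "\<And>w. \<lbrakk>w \<in> ball 0 \<epsilon>; 0 < Im w\<rbrakk> \<Longrightarrow> h w = g (\<eta> w)"
    by (rule conformal_map_in_boundary_chart[OF ch bih lim], rule that; assumption)
  have \<eta>r: "\<eta> w \<in> ball 0 r" if "w \<in> ball 0 \<epsilon>" for w using \<eta>(4) that by blast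
  have g\<eta>: "(\<lambda>w. g (\<eta> w)) holomorphic_on ball 0 \<epsilon>"
    using holomorphic_on_compose_gen[OF \<eta>(1) g(1) \<eta>(4)] by (simp add: o_def)
  have inj_g\<eta>: "inj_on (\<lambda>w. g (\<eta> w)) (ball 0 \<epsilon>)"
    using comp_inj_on[OF \<eta>(2) inj_on_subset[OF g(2) \<eta>(4)]] by (simp add: o_def)
  have real_arc: "g (\<eta> (of_real x)) \<in> \<gamma> ` I \<and> g (\<eta> (of_real x)) \<notin> \<Omega>" if x: "\<bar>x\<bar> < \<epsilon>" for x :: real
  proof -
    have xb: "complex_of_real x \<in> ball 0 \<epsilon>" using x by simp
    \<comment> \<open>Commuting with conjugation makes \<eta> real on the real axis.\<close>
    have "cnj (\<eta> (of_real x)) = \<eta> (of_real x)" using \<eta>(5)[OF xb] by simp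
    then have im: "Im (\<eta> (of_real x)) = 0" by (simp add: complex_eq_iff)
    then have e: "\<eta> (of_real x) = of_real (Re (\<eta> (of_real x)))" by (simp add: complex_eq_iff)
    have "\<bar>Re (\<eta> (of_real x))\<bar> < r" using \<eta>r[OF xb] abs_Re_le_cmod[of "\<eta> (of_real x)"] by simp
    then have "g (of_real (Re (\<eta> (of_real x)))) \<in> \<gamma> ` I" by (rule arc)
    then show ?thesis using side[OF \<eta>r[OF xb]] im by (simp flip: e)
  qed
  define \<tau> where "\<tau> x = inv_into I \<gamma> (g (\<eta> (complex_of_real x)))" for x
  have \<tau>: "\<tau> x \<in> I" "\<gamma> (\<tau> x) = g (\<eta> (of_real x))" if "\<bar>x\<bar> < \<epsilon>" for x
    using real_arc[OF that] by (auto simp: \<tau>_def inv_into_into f_inv_into_f)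
  have \<tau>0: "\<tau> 0 = s" using \<gamma> g(3) \<eta>(3) by (simp add: \<tau>_def inv_into_f_eq)
  have "continuous_on {- \<epsilon><..<\<epsilon>} (\<lambda>x. g (\<eta> (of_real x)))"
    by (rule continuous_on_compose2[OF holomorphic_on_imp_continuous_on[OF g\<eta>]])
      (auto intro!: continuous_intros)
  then have "continuous_on {- \<epsilon><..<\<epsilon>} \<tau>"
    unfolding \<tau>_def by (rule continuous_on_compose2[OF \<gamma>(2)]) (use real_arc in \<open>auto simp: abs_less_iff\<close>)
  moreover have "inj_on \<tau> {- \<epsilon><..<\<epsilon>}"
  proof (rule inj_onI)
    fix x y assume xy: "x \<in> {- \<epsilon><..<\<epsilon>}" "y \<in> {- \<epsilon><..<\<epsilon>}" "\<tau> x = \<tau> y"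
    then have "g (\<eta> (of_real x)) = g (\<eta> (of_real y))" using \<tau>(2)[of x] \<tau>(2)[of y] by auto
    then have "complex_of_real x = of_real y" by (rule inj_onD[OF inj_g\<eta>]) (use xy in auto)
    then show "x = y" by simp
  qed
  ultimately have "(\<forall>x. 0 < x \<and> x < \<epsilon> \<longrightarrow> s < \<tau> x) \<and> (\<forall>x. - \<epsilon> < x \<and> x < 0 \<longrightarrow> \<tau> x < s) \<or>
         (\<forall>x. 0 < x \<and> x < \<epsilon> \<longrightarrow> \<tau> x < s) \<and> (\<forall>x. - \<epsilon> < x \<and> x < 0 \<longrightarrow> s < \<tau> x)"
    using inj_continuous_separates_sides[OF \<epsilon>, of \<tau>] unfolding \<tau>0 by simp
  then consider "\<forall>x. 0 < x \<and> x < \<epsilon> \<longrightarrow> s < \<tau> x" "\<forall>x. - \<epsilon> < x \<and> x < 0 \<longrightarrow> \<tau> x < s"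
    | "\<forall>x. 0 < x \<and> x < \<epsilon> \<longrightarrow> \<tau> x < s" "\<forall>x. - \<epsilon> < x \<and> x < 0 \<longrightarrow> s < \<tau> x"
    by (elim disjE conjE)
  \<comment> \<open>How \<open>h\<close> is oriented against \<gamma> is unknown, so A and B are a
    and b in either order; the symmetry depends only on their sum.\<close>
  then obtain A B where AB: "A = a \<and> B = b \<or> A = b \<and> B = a"
    and A: "\<And>x. \<lbrakk>0 < x; x < \<epsilon>\<rbrakk> \<Longrightarrow> (\<phi> \<longlongrightarrow> A) (at (g (\<eta> (of_real x))) within \<Omega>)"
    and B: "\<And>x. \<lbrakk>- \<epsilon> < x; x < 0\<rbrakk> \<Longrightarrow> (\<phi> \<longlongrightarrow> B) (at (g (\<eta> (of_real x))) within \<Omega>)"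
  proof cases
    case 1
    show ?thesis
    proof (rule that[of b a])
      show "(\<phi> \<longlongrightarrow> b) (at (g (\<eta> (of_real x))) within \<Omega>)" if "0 < x" "x < \<epsilon>" for x
        using b[OF \<tau>(1) 1(1)[rule_format, OF conjI[OF that]]] \<tau>(2)[of x] that by auto
      show "(\<phi> \<longlongrightarrow> a) (at (g (\<eta> (of_real x))) within \<Omega>)" if "- \<epsilon> < x" "x < 0" for x
        using a[OF \<tau>(1) 1(2)[rule_format, OF conjI[OF that]]] \<tau>(2)[of x] that by auto
    qed simp
  next
    case 2
    show ?thesis
    proof (rule that[of a b])
      show "(\<phi> \<longlongrightarrow> a) (at (g (\<eta> (of_real x))) within \<Omega>)" if "0 < x" "x < \<epsilon>" for x
        using a[OF \<tau>(1) 2(1)[rule_format, OF conjI[OF that]]] \<tau>(2)[of x] that by auto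
      show "(\<phi> \<longlongrightarrow> b) (at (g (\<eta> (of_real x))) within \<Omega>)" if "- \<epsilon> < x" "x < 0" for x
        using b[OF \<tau>(1) 2(2)[rule_format, OF conjI[OF that]]] \<tau>(2)[of x] that by auto
    qed simp
  qed
  obtain P where P: "P holomorphic_on \<Omega>" "\<And>z. z \<in> \<Omega> \<Longrightarrow> \<phi> z = Re (P z)"
    using harmonic_on_eq_Re_holomorphic[OF \<phi>(1) \<Omega>] by metis
  obtain M where M: "\<And>z. z \<in> \<Omega> \<Longrightarrow> \<bar>\<phi> z\<bar> \<le> M"
    using \<phi>(2) by (auto simp: bounded_iff)
  have h: "h holomorphic_on upper_half_plane" "\<And>w. 0 < Im w \<Longrightarrow> h w \<in> \<Omega>"
    using bih by (auto simp: biholomorphic_def bij_betw_def upper_half_plane_def)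
  have approach: "((\<lambda>y. Re (P (h (Complex x y)))) \<longlongrightarrow> C) (at_right 0)"
    if x: "\<bar>x\<bar> < \<epsilon>" and C: "(\<phi> \<longlongrightarrow> C) (at (g (\<eta> (of_real x))) within \<Omega>)" for x C
  proof -
    have ev: "\<forall>\<^sub>F y in at_right 0. 0 < y \<and> Complex x y \<in> ball 0 \<epsilon>"
    proof (rule eventually_at_rightI[of 0 "\<epsilon> - \<bar>x\<bar>"])
      fix y assume "y \<in> {0<..<\<epsilon> - \<bar>x\<bar>}"
      then show "0 < y \<and> Complex x y \<in> ball 0 \<epsilon>" using cmod_le[of "Complex x y"] by auto
    qed (use x in simp)
    have "isCont (\<lambda>w. g (\<eta> w)) (of_real x)"
      using g\<eta> x holomorphic_on_imp_continuous_on continuous_on_eq_continuous_at[OF open_ball] by force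
    moreover have "((\<lambda>y. Complex x y) \<longlongrightarrow> Complex x 0) (at_right 0)" by (intro tendsto_intros)
    then have "((\<lambda>y. Complex x y) \<longlongrightarrow> of_real x) (at_right 0)" by (simp add: complex_of_real_def)
    ultimately have "((\<lambda>y. g (\<eta> (Complex x y))) \<longlongrightarrow> g (\<eta> (of_real x))) (at_right 0)"
      by (rule isCont_tendsto_compose)
    then have "((\<lambda>y. h (Complex x y)) \<longlongrightarrow> g (\<eta> (of_real x))) (at_right 0)"
      by (rule Lim_transform_eventually) (use ev in \<open>eventually_elim, simp add: h\<eta>\<close>)
    \<comment> \<open>The punctured filter also demands that the limit point is never attained; it
      lies off \<Omega>.\<close>
    moreover have "\<forall>\<^sub>F y in at_right 0. h (Complex x y) \<in> \<Omega> \<and> h (Complex x y) \<noteq> g (\<eta> (of_real x))"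
      using ev
    proof eventually_elim
      case (elim y)
      then have "h (Complex x y) \<in> \<Omega>" by (intro h(2)) simp
      then show ?case using real_arc[OF x] by metis
    qed
    ultimately have "filterlim (\<lambda>y. h (Complex x y)) (at (g (\<eta> (of_real x))) within \<Omega>) (at_right 0)"
      by (simp add: filterlim_at)
    from filterlim_compose[OF C this] have "((\<lambda>y. \<phi> (h (Complex x y))) \<longlongrightarrow> C) (at_right 0)" .
    then show ?thesis
      by (rule Lim_transform_eventually) (use ev in \<open>eventually_elim, simp add: h P\<close>)
  qed
  obtain L where L: "L holomorphic_on ball 0 \<epsilon>" "\<And>z. z \<in> ball 0 \<epsilon> \<Longrightarrow> Re (L (cnj z)) = - Re (L z)"
    "\<And>\<rho> \<theta>. \<lbrakk>0 < \<rho>; \<rho> < \<epsilon>; 0 < \<theta>; \<theta> < pi\<rbrakk> \<Longrightarrow>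
       Re (P (h (rcis \<rho> \<theta>))) = A + (B - A) * \<theta> / pi + Re (L (rcis \<rho> \<theta>))"
  proof (rule half_disc_step_boundary_values[OF \<epsilon>, of "\<lambda>w. P (h w)" M A B])
    show "(\<lambda>w. P (h w)) holomorphic_on ball 0 \<epsilon> \<inter> {w. 0 < Im w}"
      using holomorphic_on_compose_gen[OF holomorphic_on_subset[OF h(1)] P(1), of "ball 0 \<epsilon> \<inter> {w. 0 < Im w}"] h(2)
      by (auto simp: o_def image_subset_iff upper_half_plane_def)
    show "\<bar>Re (P (h w))\<bar> \<le> M" if "0 < Im w" for w using M[OF h(2)[OF that]] P(2)[OF h(2)[OF that]] by simp
    show "((\<lambda>y. Re (P (h (Complex x y)))) \<longlongrightarrow> A) (at_right 0)" if "0 < x" "x < \<epsilon>" for x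
      using approach[OF _ A[OF that]] that by simp
    show "((\<lambda>y. Re (P (h (Complex x y)))) \<longlongrightarrow> B) (at_right 0)" if "x < 0" "- \<epsilon> < x" for x
      using approach[OF _ B] that by simp
  qed (rule that)
  define V where "V = {- \<epsilon><..<\<epsilon>} \<times> {0<..<pi}"
  define Y where "Y q = (g (\<eta> (rcis (fst q) (snd q))), A + (B - A) * snd q / pi + Re (L (rcis (fst q) (snd q))))" for q
  have Vb: "rcis (fst q) (snd q) \<in> ball 0 \<epsilon>" if "q \<in> V" for q using that by (auto simp: V_def)
  \<comment> \<open>Oddness at the fixed point 0; hence on r = 0 the height is exactly affine in
    \<theta>.\<close>
  have L0: "Re (L 0) = 0" using L(2)[of 0] \<epsilon> by simp
  show ?thesis
    unfolding extends_across_via_def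
  proof (intro exI[of _ V] exI[of _ Y] conjI)
    show "open V" by (simp add: V_def open_Times)
    show "V \<subseteq> UNIV \<times> {0<..<pi}" "{0} \<times> {0<..<pi} \<subseteq> V" using \<epsilon> by (auto simp: V_def)
    have swap: "polar_swap q \<in> V" if "q \<in> V" for q using that by (auto simp: V_def polar_swap_def)
    have "polar_swap (polar_swap q) = q" for q by (simp add: polar_swap_def split_beta)
    then show "polar_swap ` V = V" using swap by (metis imageI image_subsetI subsetI subset_antisym)
    show "real_analytic_on Y V"
    proof (rule real_analytic_on_double_power_series)
      fix q assume "q \<in> V"
      then have q: "\<bar>fst q\<bar> < \<epsilon>" by (auto simp: V_def)
      have "double_power_series_at (\<lambda>x. (g (\<eta> (rcis (fst x) (snd x))), 0 :: real)) q"
        by (rule double_power_series_at_bounded_linear[OF bounded_linear_Pair[OF bounded_linear_ident bounded_linear_zero]])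
          (rule double_power_series_at_holomorphic_rcis[OF g\<eta> q])
      moreover have "double_power_series_at (\<lambda>x. (0 :: complex, Re (L (rcis (fst x) (snd x))))) q"
        by (rule double_power_series_at_bounded_linear[OF bounded_linear_Pair[OF bounded_linear_zero bounded_linear_Re]])
          (rule double_power_series_at_holomorphic_rcis[OF L(1) q])
      ultimately have "double_power_series_at (\<lambda>x. ((0, A) + snd x *\<^sub>R (0, (B - A) / pi)) +
          ((g (\<eta> (rcis (fst x) (snd x))), 0) + (0, Re (L (rcis (fst x) (snd x)))))) q"
        by (intro double_power_series_at_add double_power_series_at_affine_snd)
      moreover have "Y = (\<lambda>x. ((0, A) + snd x *\<^sub>R (0, (B - A) / pi)) +
          ((g (\<eta> (rcis (fst x) (snd x))), 0) + (0, Re (L (rcis (fst x) (snd x))))))"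
        by (auto simp: Y_def fun_eq_iff)
      ultimately show "double_power_series_at Y q" by simp
    qed
    show "\<forall>\<rho> \<theta>. (\<rho>, \<theta>) \<in> V \<and> \<rho> > 0 \<longrightarrow> Y (\<rho>, \<theta>) = (h (rcis \<rho> \<theta>), \<phi> (h (rcis \<rho> \<theta>)))"
    proof (intro allI impI, elim conjE)
      fix \<rho> \<theta> :: real assume *: "(\<rho>, \<theta>) \<in> V" "0 < \<rho>"
      then have im: "0 < Im (rcis \<rho> \<theta>)" by (auto simp: V_def rcis_def sin_gt_zero)
      show "Y (\<rho>, \<theta>) = (h (rcis \<rho> \<theta>), \<phi> (h (rcis \<rho> \<theta>)))"
        using * L(3)[of \<rho> \<theta>] P(2)[OF h(2)[OF im]] h\<eta>[OF _ im] Vb[OF *(1)] by (simp add: Y_def V_def)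
    qed
    have "Y ` ({0} \<times> {0<..<pi}) = {p} \<times> ((\<lambda>\<theta>. A + (B - A) * \<theta> / pi) ` {0<..<pi})"
      using L0 \<eta>(3) g(3) by (force simp: Y_def)
    also have "\<dots> = isotropic_segment p a b - {(p, a), (p, b)}"
    proof -
      have "(\<lambda>\<theta>. A + (B - A) * \<theta> / pi) ` {0<..<pi} = {min a b..max a b} - {a, b}"
      proof -
        have "A \<noteq> B" using AB ab by auto
        moreover have "{min A B..max A B} - {A, B} = {min a b..max a b} - {a, b}"
          using AB by (elim disjE conjE) (simp_all add: min.commute max.commute insert_commute)
        ultimately show ?thesis using affine_image_open_segment by metis
      qed
      then show ?thesis by (auto simp only: isotropic_segment_def)
    qed
    finally show "Y ` ({0} \<times> {0<..<pi}) = isotropic_segment p a b - {(p, a), (p, b)}" .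
    show "Y ` V \<subseteq> W \<times> UNIV" using W \<eta>r Vb by (auto simp: Y_def)
    show "\<forall>q\<in>V. Y (polar_swap q) = (case Y q of (z, t) \<Rightarrow> (R z, 2 * m - t))"
    proof
      fix q assume "q \<in> V"
      note w = Vb[OF this]
      have "rcis (fst (polar_swap q)) (snd (polar_swap q)) = cnj (rcis (fst q) (snd q))"
        by (simp add: polar_swap_def split_beta rcis_polar_swap)
      moreover have "A + B = 2 * m" using AB ab by auto
      moreover have "(B - A) * (pi - snd q) / pi = B - A - (B - A) * snd q / pi"
        by (simp add: field_simps)
      ultimately show "Y (polar_swap q) = (case Y q of (z, t) \<Rightarrow> (R z, 2 * m - t))"
        using \<eta>(5)[OF w] L(2)[OF w] R[OF \<eta>r[OF w]]
        by (simp add: Y_def polar_swap_def split_beta)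
    qed
  qed
qed

section \<open>Conformal extension of analytic arcs\<close>

text \<open>With the Jordan curve carried to the unit circle and p to 1, \<open>Arg\<close> is a
  coordinate near p, and \<gamma> read in it passes through 0 from one side to the other. By
  connectedness a short parameter interval already covers all points of the curve near p, so no
  other part of the arc can come close to p.\<close>

lemma Jordan_curve_subarc_homeomorphism:
  fixes \<gamma> :: "real \<Rightarrow> complex"
  assumes "Jordan_domain \<Omega>" "open I" and \<gamma>: "continuous_on I \<gamma>" "inj_on \<gamma> I" "\<gamma> ` I \<subseteq> frontier \<Omega>"
  shows "continuous_on (\<gamma> ` I) (inv_into I \<gamma>)"
proof -
  obtain c where c: "simple_path c" "pathfinish c = pathstart c" "\<Omega> = inside (path_image c)"
    using assms(1) by (auto simp: Jordan_domain_def)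
  define J where "J = path_image c"
  have J: "\<gamma> ` I \<subseteq> J" using Jordan_inside_outside[OF c(1,2)] c(3) \<gamma>(3) by (simp add: J_def)
  obtain q q' where q: "homeomorphism J (sphere (0 :: complex) 1) q q'"
    using homeomorphic_simple_path_image_circle[OF c(1,2), of 1 0] by (auto simp: homeomorphic_def J_def)
  have qn: "norm (q y) = 1" if "y \<in> J" for y using q that by (force simp: homeomorphism_def)
  have q_inj: "y = y'" if "y \<in> J" "y' \<in> J" "q y = q y'" for y y' using q that by (metis homeomorphism_def)
  have contq: "continuous_on J q" using q by (simp add: homeomorphism_def)
  show ?thesis
    unfolding continuous_on_iff
  proof (intro ballI allI impI)
    fix p and e :: real assume "p \<in> \<gamma> ` I" and e: "0 < e"
    then obtain s where s: "s \<in> I" "p = \<gamma> s" by blast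
    have pJ: "p \<in> J" using J s by blast
    define Q where "Q y = q y / q p" for y
    have qp: "q p \<noteq> 0" using qn[OF pJ] by auto
    have Qp: "Q p = 1" using qp by (simp add: Q_def)
    have Qn: "norm (Q y) = 1" if "y \<in> J" for y using qn that pJ by (simp add: Q_def norm_divide)
    have contQ: "continuous_on J Q" unfolding Q_def by (intro continuous_intros contq) (use qp in auto)
    have Arg_inj: "y = y'" if "y \<in> J" "y' \<in> J" "Arg (Q y) = Arg (Q y')" for y y'
    proof -
      have "Q y = Q y'" using Arg_eq[of "Q y"] Arg_eq[of "Q y'"] Qn that by (metis norm_zero zero_neq_one)
      then show ?thesis using q_inj that(1,2) qp by (simp add: Q_def)
    qed
    have contQ\<gamma>: "continuous_on I (\<lambda>x. Q (\<gamma> x))"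
      by (rule continuous_on_compose2[OF contQ \<gamma>(1) J])
    obtain d0 where d0: "0 < d0" "\<And>x. \<lbrakk>x \<in> I; dist x s < d0\<rbrakk> \<Longrightarrow> dist (Q (\<gamma> x)) (Q (\<gamma> s)) < 1"
      using contQ\<gamma> s(1) unfolding continuous_on_iff by (metis zero_less_one)
    obtain d1 where d1: "0 < d1" "ball s d1 \<subseteq> I" using openE assms(2) s(1) by blast
    \<comment> \<open>d < d1 keeps the closed interval \<open>K\<close> inside I, d < d0 keeps the
      circle values off the cut of \<open>Arg\<close>, and d < e gives the final estimate.\<close>
    define d where "d = min (min (d0/2) (d1/2)) (e/2)"
    have d: "0 < d" "d < d0" "d < d1" "d < e" using d0 d1 e by (auto simp: d_def)
    define K where "K = {s - d..s + d}"
    have K: "K \<subseteq> I" using d d1 by (force simp: K_def dist_real_def)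
    have np: "Q y \<notin> \<real>\<^sub>\<le>\<^sub>0" if "dist (Q y) 1 < 1" for y
    proof
      assume "Q y \<in> \<real>\<^sub>\<le>\<^sub>0"
      then have "Re (Q y) \<le> 0" by (simp add: complex_nonpos_Reals_iff)
      then show False using that abs_Re_le_cmod[of "Q y - 1"] by (simp add: dist_norm)
    qed
    define \<tau> where "\<tau> x = Arg (Q (\<gamma> x))" for x
    have np\<gamma>: "Q (\<gamma> x) \<notin> \<real>\<^sub>\<le>\<^sub>0" if "x \<in> K" for x
    proof (rule np)
      show "dist (Q (\<gamma> x)) 1 < 1" using d0(2)[of x] that K d Qp s by (auto simp: K_def dist_real_def)
    qed
    have "continuous_on K \<tau>"
      unfolding \<tau>_def by (intro continuous_on_Arg' continuous_on_subset[OF contQ\<gamma> K] np\<gamma>)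
    moreover have "inj_on \<tau> K"
    proof (rule inj_onI)
      fix x y assume "x \<in> K" "y \<in> K" "\<tau> x = \<tau> y"
      then have "\<gamma> x = \<gamma> y" using Arg_inj[of "\<gamma> x" "\<gamma> y"] J K by (auto simp: \<tau>_def)
      then show "x = y" using \<gamma>(2) K \<open>x \<in> K\<close> \<open>y \<in> K\<close> by (meson inj_onD subsetD)
    qed
    moreover have \<tau>s: "\<tau> s = 0" using Qp s by (simp add: \<tau>_def)
    ultimately have alt: "\<tau> (s - d) < 0 \<and> 0 < \<tau> (s + d) \<or> \<tau> (s + d) < 0 \<and> 0 < \<tau> (s - d)"
      using continuous_inj_imp_mono[of "s - d" s "s + d" \<tau>] d(1) by (simp add: K_def)
    have conn: "connected (\<tau> ` K)"
      using \<open>continuous_on K \<tau>\<close> by (intro connected_continuous_image) (auto simp: K_def)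
    have ends: "\<tau> (s - d) \<in> \<tau> ` K" "\<tau> (s + d) \<in> \<tau> ` K" using d(1) by (auto simp: K_def)
    \<comment> \<open>The end values lie on opposite sides of 0, so every t closer to 0 than both of
      them is attained on \<open>K\<close>.\<close>
    define \<mu> where "\<mu> = min \<bar>\<tau> (s - d)\<bar> \<bar>\<tau> (s + d)\<bar>"
    have \<mu>: "0 < \<mu>" using alt by (auto simp: \<mu>_def)
    have sub: "t \<in> \<tau> ` K" if "\<bar>t\<bar> < \<mu>" for t
      using alt
    proof
      assume *: "\<tau> (s - d) < 0 \<and> 0 < \<tau> (s + d)"
      then have "t \<in> {\<tau> (s - d)..\<tau> (s + d)}" using that by (auto simp: \<mu>_def)
      then show ?thesis using connected_contains_Icc[OF conn ends(1,2)] by blast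
    next
      assume *: "\<tau> (s + d) < 0 \<and> 0 < \<tau> (s - d)"
      then have "t \<in> {\<tau> (s + d)..\<tau> (s - d)}" using that by (auto simp: \<mu>_def)
      then show ?thesis using connected_contains_Icc[OF conn ends(2,1)] by blast
    qed
    have "isCont Arg (Q p)" using Qp by (intro continuous_at_Arg np) simp
    moreover have "(Q \<longlongrightarrow> Q p) (at p within J)" using contQ pJ by (simp add: continuous_on_def)
    ultimately have "((\<lambda>y. Arg (Q y)) \<longlongrightarrow> Arg (Q p)) (at p within J)" by (rule isCont_tendsto_compose)
    then have "((\<lambda>y. Arg (Q y)) \<longlongrightarrow> 0) (at p within J)" using Qp by simp
    then have "\<forall>\<^sub>F y in at p within J. dist (Arg (Q y)) 0 < \<mu>" using \<mu> by (rule tendstoD)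
    then obtain d' where d': "0 < d'" "\<And>y. \<lbrakk>y \<in> J; y \<noteq> p; dist y p < d'\<rbrakk> \<Longrightarrow> \<bar>Arg (Q y)\<bar> < \<mu>"
      by (auto simp: eventually_at)
    have "dist (inv_into I \<gamma> y) (inv_into I \<gamma> p) < e" if y: "y \<in> \<gamma> ` I" "dist y p < d'" for y
    proof (cases "y = p")
      case False
      have "Arg (Q y) \<in> \<tau> ` K" using d'(2)[of y] y J False by (intro sub) auto
      then obtain x where x: "x \<in> K" "Arg (Q y) = Arg (Q (\<gamma> x))" by (auto simp: \<tau>_def)
      then have "y = \<gamma> x" using Arg_inj[of y "\<gamma> x"] y J K by blast
      then have "inv_into I \<gamma> y = x" using x K \<gamma>(2) by (meson inv_into_f_f subsetD)
      moreover have "inv_into I \<gamma> p = s" using s \<gamma>(2) by simp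
      ultimately show ?thesis using x(1) d by (auto simp: K_def dist_real_def)
    qed (use e in simp)
    then show "\<exists>d>0. \<forall>y\<in>\<gamma> ` I. dist y p < d \<longrightarrow> dist (inv_into I \<gamma> y) (inv_into I \<gamma> p) < e"
      using d'(1) by blast
  qed
qed

lemma real_analytic_on_power_series:
  fixes \<gamma> :: "real \<Rightarrow> complex"
  assumes "real_analytic_on \<gamma> I" "p \<in> I"
  obtains e c where "0 < e" "\<And>x. \<bar>x - p\<bar> < e \<Longrightarrow> (\<lambda>k. c k * of_real (x - p) ^ k) sums \<gamma> x"
proof -
  obtain e c where e: "0 < e" and c: "\<And>x. x \<in> ball p e \<Longrightarrow>
      ((\<lambda>k. (\<Prod>b\<in>Basis. ((x - p) \<bullet> b) ^ k b) *\<^sub>R c k) has_sum \<gamma> x) (Basis \<rightarrow>\<^sub>E UNIV)"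
    using assms unfolding real_analytic_on_def by blast
  define h where "h k = (\<lambda>b :: real. if b = 1 then k else undefined)" for k :: nat
  have bij: "bij_betw h UNIV (Basis \<rightarrow>\<^sub>E UNIV)"
    by (rule bij_betw_byWitness[of _ "\<lambda>\<kappa>. \<kappa> 1"])
      (auto simp: h_def fun_eq_iff PiE_def extensional_def)
  show ?thesis
  proof (rule that[OF e, of "\<lambda>k. c (h k)"])
    fix x assume "\<bar>x - p\<bar> < e"
    then have "x \<in> ball p e" by (auto simp: dist_real_def)
    from c[OF this] have "((\<lambda>k. of_real (x - p) ^ k * c (h k)) has_sum \<gamma> x) UNIV"
      unfolding has_sum_reindex_bij_betw[OF bij, symmetric]
      by (simp add: h_def scaleR_conv_of_real)
    then show "(\<lambda>k. c (h k) * of_real (x - p) ^ k) sums \<gamma> x"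
      by (intro has_sum_imp_sums) (simp add: mult.commute)
  qed
qed

lemma islimpt_of_real_image:
  assumes "open A" "x \<in> A"
  shows "complex_of_real x islimpt complex_of_real ` A"
  unfolding islimpt_approachable
proof (intro allI impI)
  fix e :: real assume e: "0 < e"
  obtain d where d: "0 < d" "ball x d \<subseteq> A" using assms openE by blast
  define y where "y = x + min (e/2) (d/2)"
  have "y \<in> A" "y \<noteq> x" "dist y x < e" using d e by (auto simp: y_def dist_real_def subset_iff min_def)
  then show "\<exists>z\<in>complex_of_real ` A. z \<noteq> complex_of_real x \<and> dist z (complex_of_real x) < e"
    by (intro bexI[of _ "of_real y"]) (auto simp: dist_norm simp flip: of_real_diff)
qed

text \<open>The power series define holomorphic functions on discs with real centres. Two
  intersecting discs have a convex intersection that contains a real interval, so the identity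
  theorem makes the functions agree there and they glue.\<close>

lemma real_analytic_on_holomorphic_extension:
  fixes \<gamma> :: "real \<Rightarrow> complex"
  assumes "real_analytic_on \<gamma> I"
  obtains N G where "open N" "complex_of_real ` I \<subseteq> N" "G holomorphic_on N" "\<And>x. x \<in> I \<Longrightarrow> G (of_real x) = \<gamma> x"
proof -
  have "\<exists>e c. 0 < e \<and> (\<forall>x. \<bar>x - p\<bar> < e \<longrightarrow> (\<lambda>k. c k * of_real (x - p) ^ k) sums \<gamma> x)" if "p \<in> I" for p
    using real_analytic_on_power_series[OF assms that] by metis
  then obtain e c where e: "\<And>p. p \<in> I \<Longrightarrow> 0 < e p"
    and c: "\<And>p x. \<lbrakk>p \<in> I; \<bar>x - p\<bar> < e p\<rbrakk> \<Longrightarrow> (\<lambda>k. c p k * of_real (x - p) ^ k) sums \<gamma> x"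
    by metis
  define B where "B p = ball (complex_of_real p) (e p)" for p
  define H where "H p z = (\<Sum>k. c p k * (z - of_real p) ^ k)" for p z
  have Hol: "H p holomorphic_on B p" if p: "p \<in> I" for p
    unfolding B_def
  proof (rule power_series_holomorphic)
    fix w assume "w \<in> ball (complex_of_real p) (e p)"
    then obtain t where t: "norm (w - of_real p) < t" "t < e p"
      using dense by (auto simp: dist_norm norm_minus_commute)
    then have "0 < t" using norm_ge_zero order_le_less_trans by blast
    then have "summable (\<lambda>k. c p k * of_real t ^ k)"
      using c[OF p, of "p + t"] t by (auto simp: sums_iff)
    then have "summable (\<lambda>k. c p k * (w - of_real p) ^ k)"
      by (rule powser_inside) (use t \<open>0 < t\<close> in auto)
    then show "(\<lambda>k. c p k * (w - of_real p) ^ k) sums H p w" by (simp add: H_def summable_sums)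
  qed
  have Hreal: "H p (of_real x) = \<gamma> x" if "p \<in> I" "\<bar>x - p\<bar> < e p" for p x
    using c[OF that] by (simp add: H_def sums_iff)
  have agree: "H p z = H p' z" if p: "p \<in> I" "p' \<in> I" and z: "z \<in> B p \<inter> B p'" for p p' z
  proof -
    define A where "A = ball p (e p) \<inter> ball p' (e p')"
    have "\<bar>Re z - p\<bar> \<le> norm (z - of_real p)" "\<bar>Re z - p'\<bar> \<le> norm (z - of_real p')"
      using abs_Re_le_cmod[of "z - of_real p"] abs_Re_le_cmod[of "z - of_real p'"] by auto
    \<comment> \<open>As the centres are real, the real part of a common point is again a common
      point.\<close>
    then have reA: "Re z \<in> A"
      using z by (auto simp: A_def B_def dist_norm norm_minus_commute dist_real_def abs_minus_commute)
    have AB: "complex_of_real ` A \<subseteq> B p \<inter> B p'"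
      by (auto simp: A_def B_def dist_norm simp flip: of_real_diff)
    have "H p z - H p' z = 0"
    proof (rule analytic_continuation[of "\<lambda>z. H p z - H p' z" "B p \<inter> B p'" "complex_of_real ` A" "of_real (Re z)"])
      show "(\<lambda>z. H p z - H p' z) holomorphic_on B p \<inter> B p'"
        by (intro holomorphic_intros holomorphic_on_subset[OF Hol[OF p(1)]] holomorphic_on_subset[OF Hol[OF p(2)]]) auto
      show "open (B p \<inter> B p')" "connected (B p \<inter> B p')"
        by (auto simp: B_def intro!: convex_connected convex_Int)
      show "complex_of_real (Re z) islimpt complex_of_real ` A"
        by (rule islimpt_of_real_image[OF _ reA]) (simp add: A_def open_Int)
      show "H p w - H p' w = 0" if "w \<in> complex_of_real ` A" for w
        using that Hreal p by (auto simp: A_def dist_real_def abs_minus_commute)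
    qed (use AB reA z in auto)
    then show ?thesis by simp
  qed
  define N where "N = (\<Union>p\<in>I. B p)"
  define G where "G z = H (SOME p. p \<in> I \<and> z \<in> B p) z" for z
  have GH: "G z = H p z" if "p \<in> I" "z \<in> B p" for p z
  proof -
    have "(SOME p. p \<in> I \<and> z \<in> B p) \<in> I \<and> z \<in> B (SOME p. p \<in> I \<and> z \<in> B p)"
      using someI[of "\<lambda>p. p \<in> I \<and> z \<in> B p" p] that by blast
    then show ?thesis unfolding G_def using agree that by blast
  qed
  have cen: "of_real p \<in> B p" if "p \<in> I" for p using e[OF that] by (simp add: B_def)
  show ?thesis
  proof (rule that[of N G])
    show "open N" by (auto simp: N_def B_def)
    show "complex_of_real ` I \<subseteq> N" using cen by (auto simp: N_def)
    show "G holomorphic_on N"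
      unfolding N_def
    proof (rule holomorphic_on_UN_open)
      show "G holomorphic_on B p" if "p \<in> I" for p
        using Hol[OF that] by (rule holomorphic_transform) (rule GH[OF that, symmetric])
    qed (simp add: B_def)
    show "G (of_real x) = \<gamma> x" if "x \<in> I" for x
      using GH[OF that cen[OF that]] Hreal[OF that] e[OF that] by simp
  qed
qed

text \<open>
  Two points of the neighbourhood with the same image lie near parameters whose images are close;
  since \<open>\<gamma>\<close> is an embedding, these parameters are close, and both points lie in one disc on which
  the continuation is injective.
\<close>
lemma regular_simple_analytic_conformal_extension:
  assumes reg: "regular_simple_analytic \<gamma> I" and emb: "continuous_on (\<gamma> ` I) (inv_into I \<gamma>)"
  obtains N G where "open N" "complex_of_real ` I \<subseteq> N" "cnj ` N = N" "G holomorphic_on N" "inj_on G N"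
    "\<And>x. x \<in> I \<Longrightarrow> G (of_real x) = \<gamma> x"
proof -
  have I: "open I" and inj: "inj_on \<gamma> I" and an: "real_analytic_on \<gamma> I"
    and nz: "\<And>s. s \<in> I \<Longrightarrow> vector_derivative \<gamma> (at s) \<noteq> 0"
    using reg by (auto simp: regular_simple_analytic_def)
  obtain N0 G where N0: "open N0" "complex_of_real ` I \<subseteq> N0" "G holomorphic_on N0"
    and G: "\<And>x. x \<in> I \<Longrightarrow> G (of_real x) = \<gamma> x"
    using real_analytic_on_holomorphic_extension[OF an] by metis
  have "\<exists>d>0. ball (complex_of_real s) d \<subseteq> N0 \<and> inj_on G (ball (of_real s) d)" if s: "s \<in> I" for s
  proof -
    have "(G has_field_derivative deriv G (of_real s)) (at (of_real s))"
      using holomorphic_derivI[OF N0(3,1)] N0(2) s by blast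
    then have "((\<lambda>x. G (of_real x)) has_vector_derivative deriv G (of_real s)) (at s)"
      by (rule has_vector_derivative_real_field)
    then have "(\<gamma> has_vector_derivative deriv G (of_real s)) (at s)"
      by (rule has_vector_derivative_transform_within_open[OF _ I s]) (rule G)
    \<comment> \<open>Regularity of the arc passes to the continuation and makes it locally
      injective.\<close>
    then have "deriv G (of_real s) \<noteq> 0" using nz[OF s] vector_derivative_at by metis
    then show ?thesis
      using has_complex_derivative_locally_injective[OF N0(3), of "of_real s"] N0(1,2) s by (metis image_subset_iff)
  qed
  then obtain d where d: "\<And>s. s \<in> I \<Longrightarrow> 0 < d s" "\<And>s. s \<in> I \<Longrightarrow> ball (complex_of_real s) (d s) \<subseteq> N0"
      "\<And>s. s \<in> I \<Longrightarrow> inj_on G (ball (of_real s) (d s))"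
    by metis
  \<comment> \<open>Continuity of the inverse of \<gamma>: close images force close
    parameters.\<close>
  have "\<exists>\<rho>>0. \<forall>x\<in>I. dist (\<gamma> x) (\<gamma> s) < \<rho> \<longrightarrow> dist x s < d s / 4" if s: "s \<in> I" for s
  proof -
    have "\<exists>\<rho>>0. \<forall>y\<in>\<gamma> ` I. dist y (\<gamma> s) < \<rho> \<longrightarrow> dist (inv_into I \<gamma> y) (inv_into I \<gamma> (\<gamma> s)) < d s / 4"
    proof -
      have "\<gamma> s \<in> \<gamma> ` I" "0 < d s / 4" using s d(1)[OF s] by auto
      then show ?thesis using emb unfolding continuous_on_iff by blast
    qed
    then show ?thesis using inj s by simp
  qed
  then obtain \<rho> where \<rho>: "\<And>s. s \<in> I \<Longrightarrow> 0 < \<rho> s"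
      "\<And>s x. \<lbrakk>s \<in> I; x \<in> I; dist (\<gamma> x) (\<gamma> s) < \<rho> s\<rbrakk> \<Longrightarrow> dist x s < d s / 4"
    by metis
  have "\<exists>e>0. e \<le> d s / 4 \<and> (\<forall>z\<in>ball (complex_of_real s) e. dist (G z) (\<gamma> s) < \<rho> s / 4)" if s: "s \<in> I" for s
  proof -
    have sN: "complex_of_real s \<in> N0" using s N0(2) by blast
    have "continuous (at (of_real s)) G"
      using N0(1,3) sN holomorphic_on_imp_continuous_on continuous_on_eq_continuous_at by blast
    then obtain e where "0 < e" "\<And>z. dist z (of_real s) < e \<Longrightarrow> dist (G z) (G (of_real s)) < \<rho> s / 4"
      using \<rho>(1)[OF s] unfolding continuous_at_eps_delta by (metis zero_less_divide_iff zero_less_numeral)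
    then show ?thesis using d(1)[OF s] G[OF s]
      by (intro exI[of _ "min e (d s / 4)"]) (auto simp: dist_commute)
  qed
  then obtain e where e: "\<And>s. s \<in> I \<Longrightarrow> 0 < e s" "\<And>s. s \<in> I \<Longrightarrow> e s \<le> d s / 4"
      "\<And>s z. \<lbrakk>s \<in> I; z \<in> ball (complex_of_real s) (e s)\<rbrakk> \<Longrightarrow> dist (G z) (\<gamma> s) < \<rho> s / 4"
    by metis
  define N where "N = (\<Union>s\<in>I. ball (complex_of_real s) (e s))"
  have NN0: "N \<subseteq> N0"
  proof
    fix z assume "z \<in> N"
    then obtain s where s: "s \<in> I" "z \<in> ball (of_real s) (e s)" by (auto simp: N_def)
    then have "z \<in> ball (of_real s) (d s)" using e(2)[OF s(1)] d(1)[OF s(1)] by auto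
    then show "z \<in> N0" using d(2)[OF s(1)] by blast
  qed
  \<comment> \<open>The larger \<rho> exceeds the distance of \<gamma> s and \<gamma> s', which
    gives |s' - s| < d s / 4. The quarters then put both points into the disc about whichever of s,
    s' has the larger d, and there \<open>G\<close> is injective.\<close>
  have key: "z = z'"
    if s: "s \<in> I" "s' \<in> I" and z: "z \<in> ball (of_real s) (e s)" "z' \<in> ball (of_real s') (e s')"
      and eq: "G z = G z'" and le: "\<rho> s' \<le> \<rho> s" for s s' z z'
  proof -
    have "dist (\<gamma> s') (\<gamma> s) \<le> dist (G z') (\<gamma> s') + dist (G z) (\<gamma> s)"
      using eq by (metis dist_commute dist_triangle)
    also have "\<dots> < \<rho> s" using e(3)[OF s(1) z(1)] e(3)[OF s(2) z(2)] le \<rho>(1)[OF s(1)] by linarith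
    finally have "dist s' s < d s / 4" by (rule \<rho>(2)[OF s])
    then have cl: "dist (complex_of_real s') (of_real s) < d s / 4" by (simp add: dist_of_real)
    have dz: "dist (of_real s) z < e s" "dist (of_real s') z' < e s'" using z by auto
    show ?thesis
    proof (cases "d s' \<le> d s")
      case True
      have "dist (of_real s) z' \<le> dist (complex_of_real s') (of_real s) + dist (of_real s') z'"
        by (metis dist_commute dist_triangle)
      then have "z' \<in> ball (of_real s) (d s)" using cl dz e(2)[OF s(2)] True d(1)[OF s(1)] by simp
      moreover have "z \<in> ball (of_real s) (d s)" using dz e(2)[OF s(1)] d(1)[OF s(1)] by simp
      ultimately show ?thesis using d(3)[OF s(1)] eq by (meson inj_onD)
    next
      case False
      have "dist (of_real s') z \<le> dist (complex_of_real s') (of_real s) + dist (of_real s) z"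
        by (rule dist_triangle)
      then have "z \<in> ball (of_real s') (d s')" using cl dz e(2)[OF s(1)] False d(1)[OF s(1)] by simp
      moreover have "z' \<in> ball (of_real s') (d s')" using dz e(2)[OF s(2)] d(1)[OF s(2)] by simp
      ultimately show ?thesis using d(3)[OF s(2)] eq by (meson inj_onD)
    qed
  qed
  show ?thesis
  proof (rule that[of N G])
    show "open N" by (auto simp: N_def)
    show "complex_of_real ` I \<subseteq> N" using e(1) by (force simp: N_def)
    have "cnj z \<in> N" if "z \<in> N" for z
    proof -
      have "dist (of_real s) (cnj z) = dist (of_real s) z" for s
        unfolding dist_norm using complex_mod_cnj[of "of_real s - z"] by simp
      then show ?thesis using that by (auto simp: N_def)
    qed
    then show "cnj ` N = N" by (metis complex_cnj_cnj image_subsetI imageI subsetI subset_antisym)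
    show "G holomorphic_on N" using N0(3) NN0 by (rule holomorphic_on_subset)
    show "inj_on G N"
    proof (rule inj_onI)
      fix z z' assume "z \<in> N" "z' \<in> N" and eq: "G z = G z'"
      then obtain s s' where s: "s \<in> I" "s' \<in> I" "z \<in> ball (of_real s) (e s)" "z' \<in> ball (of_real s') (e s')"
        by (auto simp: N_def)
      show "z = z'"
      proof (cases "\<rho> s' \<le> \<rho> s")
        case True
        then show ?thesis using key[OF s eq] by blast
      next
        case False
        then show ?thesis using key[OF s(2,1,4,3) eq[symmetric]] by simp
      qed
    qed
  qed (rule G)
qed

theorem theorem1p1:
  fixes \<Omega> U \<Gamma> \<Gamma>\<^sub>1 \<Gamma>\<^sub>2 :: "complex set" and \<phi> :: "complex \<Rightarrow> real" and S :: "(complex \<times> real) set"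
    and z\<^sub>0 :: complex and a b m s\<^sub>0 :: real and \<gamma> :: "real \<Rightarrow> complex" and I :: "real set"
  assumes "Jordan_domain \<Omega>" and "simply_connected \<Omega>"
    and "harmonic_on \<phi> \<Omega>" and "S = graph_over \<Omega> \<phi>" and "bounded S"
    and "z\<^sub>0 \<in> frontier \<Omega>" and "open U" and "z\<^sub>0 \<in> U" and "a \<noteq> b"
    and "\<Gamma> = frontier \<Omega> \<inter> U"
    and "regular_simple_analytic \<gamma> I" and "\<Gamma> = \<gamma> ` I" and "s\<^sub>0 \<in> I" and "\<gamma> s\<^sub>0 = z\<^sub>0"
    and "\<Gamma>\<^sub>1 = \<gamma> ` {s\<in>I. s < s\<^sub>0}" and "\<Gamma>\<^sub>2 = \<gamma> ` {s\<in>I. s > s\<^sub>0}"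
    and "surface_boundary S \<inter> (U \<times> UNIV) =
           \<Gamma>\<^sub>1 \<times> {a} \<union> isotropic_segment z\<^sub>0 a b \<union> \<Gamma>\<^sub>2 \<times> {b}"
    and "m = (a + b) / 2"
  shows "extends_real_analytically_across \<Omega> \<phi> z\<^sub>0 a b \<Gamma> m"
proof -
  obtain c where c: "simple_path c" "pathfinish c = pathstart c" "\<Omega> = inside (path_image c)"
    using assms(1) by (auto simp: Jordan_domain_def)
  note J = Jordan_inside_outside[OF c(1,2)]
  have \<Omega>: "open \<Omega>" "\<Omega> \<noteq> {}" and "bounded \<Omega>" using J c(3) by auto
  then have \<Omega>': "\<Omega> \<noteq> UNIV" using not_bounded_UNIV by blast
  note \<Gamma> = assms(10,12)
  have reg: "open I" "inj_on \<gamma> I" "real_analytic_on \<gamma> I"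
    using assms(11) by (auto simp: regular_simple_analytic_def)
  have z0: "s\<^sub>0 \<in> I" "\<gamma> s\<^sub>0 = z\<^sub>0" "z\<^sub>0 \<in> \<Gamma>" using assms(6,8,10,13,14) by auto
  have "continuous_on I \<gamma>"
  proof -
    obtain N G where N: "complex_of_real ` I \<subseteq> N" "G holomorphic_on N" and G: "\<And>x. x \<in> I \<Longrightarrow> G (of_real x) = \<gamma> x"
      by (rule real_analytic_on_holomorphic_extension[OF reg(3)], rule that; assumption)
    have "continuous_on I (\<lambda>x. G (of_real x))"
      by (rule continuous_on_compose2[OF holomorphic_on_imp_continuous_on[OF N(2)] _ N(1)]) (intro continuous_intros)
    then show ?thesis by (simp add: G cong: continuous_on_cong)
  qed
  then have emb: "continuous_on (\<gamma> ` I) (inv_into I \<gamma>)"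
    using Jordan_curve_subarc_homeomorphism[OF assms(1) reg(1) _ reg(2)] \<Gamma> by auto
  obtain N G where N: "open N" "complex_of_real ` I \<subseteq> N" "cnj ` N = N" "G holomorphic_on N" "inj_on G N"
    and G: "\<And>x. x \<in> I \<Longrightarrow> G (of_real x) = \<gamma> x"
    by (rule regular_simple_analytic_conformal_extension[OF assms(11) emb], rule that; assumption)
  have "\<exists>X. conformal_parametrization_at \<Omega> \<phi> z\<^sub>0 X"
  proof -
    have arc: "frontier \<Omega> \<inter> U = (\<lambda>x. G (of_real x)) ` I" using \<Gamma> G by auto
    have inU: "G (of_real s\<^sub>0) \<in> U" using G z0 assms(8) by simp
    obtain r \<epsilon> where "boundary_chart \<Omega> (G (of_real s\<^sub>0)) r (\<lambda>z. G (of_real s\<^sub>0 + of_real \<epsilon> * z))"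
      by (rule boundary_chart_exists[OF assms(1,7) reg(1) z0(1) inU arc N(1,2,4,5)], rule that; assumption)
    then obtain h where "biholomorphic h upper_half_plane \<Omega>" "(h \<longlongrightarrow> z\<^sub>0) (at 0 within upper_half_plane)"
      using conformal_map_to_boundary_point_exists[OF _ \<Omega>(1) assms(2) \<Omega>' \<Omega>(2)] G z0 by metis
    then show ?thesis unfolding conformal_parametrization_at_def by blast
  qed
  moreover have "\<exists>W R. reflection_near \<Gamma> W R"
  proof -
    have "reflection_near \<Gamma> (G ` N) (\<lambda>z. G (cnj (inv_into N G z)))"
      unfolding reflection_near_def
      by (rule exI[of _ \<gamma>], rule exI[of _ I], rule exI[of _ N], rule exI[of _ G])
        (use assms(11,12) N G in auto)
    then show ?thesis by blast
  qed
  moreover have "extends_across_via X (isotropic_segment z\<^sub>0 a b - {(z\<^sub>0, a), (z\<^sub>0, b)})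
        (W \<times> UNIV) (\<lambda>(z, t). (R z, 2 * m - t))"
    if X: "conformal_parametrization_at \<Omega> \<phi> z\<^sub>0 X" and WR: "reflection_near \<Gamma> W R" for X W R
  proof -
    obtain h where h: "biholomorphic h upper_half_plane \<Omega>" "(h \<longlongrightarrow> z\<^sub>0) (at 0 within upper_half_plane)"
      and X_eq: "X = (\<lambda>w. (h w, \<phi> (h w)))"
      using X unfolding conformal_parametrization_at_def by blast
    obtain \<gamma>' I' N' G' where reg': "regular_simple_analytic \<gamma>' I'" "\<Gamma> = \<gamma>' ` I'"
      and N': "open N'" "complex_of_real ` I' \<subseteq> N'" "cnj ` N' = N'" "G' holomorphic_on N'" "inj_on G' N'"
      and G': "\<forall>s\<in>I'. G' (complex_of_real s) = \<gamma>' s" and W: "W = G' ` N'" "\<forall>w\<in>N'. R (G' w) = G' (cnj w)"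
      using WR unfolding reflection_near_def by blast
    \<comment> \<open>The reflection may come from another parametrization of \<Gamma>. The chart is
      built from its continuation \<open>G'\<close>, at its own parameter of z0, so that
      \<open>R\<close> becomes conjugation in the chart.\<close>
    obtain s where s: "s \<in> I'" "\<gamma>' s = z\<^sub>0" using z0(3) reg'(2) by blast
    have "open I'" using reg'(1) by (simp add: regular_simple_analytic_def)
    have arc: "frontier \<Omega> \<inter> U = (\<lambda>x. G' (of_real x)) ` I'" using \<Gamma>(1) reg'(2) G' by auto
    have p: "G' (of_real s) = z\<^sub>0" using G' s by simp
    then have inU: "G' (of_real s) \<in> U" using assms(8) by simp
    obtain r \<epsilon> where \<epsilon>: "\<epsilon> = 1 \<or> \<epsilon> = -1"
      and ch: "boundary_chart \<Omega> (G' (of_real s)) r (\<lambda>z. G' (of_real s + of_real \<epsilon> * z))"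
      and inN: "\<And>z. z \<in> ball 0 r \<Longrightarrow> of_real s + of_real \<epsilon> * z \<in> N'"
      and inI: "\<And>x. \<bar>x\<bar> < r \<Longrightarrow> s + \<epsilon> * x \<in> I'"
      by (rule boundary_chart_exists[OF assms(1,7) \<open>open I'\<close> s(1) inU arc N'(1,2,4,5)], rule that; assumption)
    \<comment> \<open>Over a point of the arc other than z0 the boundary hypothesis leaves a single
      height.\<close>
    have limit: "(\<phi> \<longlongrightarrow> t) (at (\<gamma> x) within \<Omega>)"
      if x: "x \<in> I" and t: "x < s\<^sub>0 \<and> t = a \<or> s\<^sub>0 < x \<and> t = b" for x t
    proof (rule graph_over_boundary_limit)
      show "bounded (graph_over \<Omega> \<phi>)" using assms(4,5) by simp
      have "\<gamma> x \<in> frontier \<Omega>" using x \<Gamma> by blast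
      then show "\<gamma> x \<notin> \<Omega>" using \<Omega>(1) frontier_disjoint_eq by blast
      fix u assume "(\<gamma> x, u) \<in> surface_boundary (graph_over \<Omega> \<phi>)"
      moreover have "\<gamma> x \<in> U" using x \<Gamma> by blast
      ultimately have "(\<gamma> x, u) \<in> \<Gamma>\<^sub>1 \<times> {a} \<union> isotropic_segment z\<^sub>0 a b \<union> \<Gamma>\<^sub>2 \<times> {b}"
        using assms(4,17) by blast
      moreover have "\<gamma> x \<noteq> z\<^sub>0" using inj_onD[OF reg(2), of x s\<^sub>0] x z0 t by auto
      moreover have "x' = x" if "x' \<in> I" "\<gamma> x' = \<gamma> x" for x' using inj_onD[OF reg(2) that(2,1) x] .
      ultimately show "u = t" using t by (force simp: assms(15,16) isotropic_segment_def)
    qed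
    show ?thesis
      unfolding X_eq
    proof (rule extends_across_via_chart[OF _ h \<Omega>(1) assms(2,3) _ _ _ reg(2) emb z0(1,2)])
      show "boundary_chart \<Omega> z\<^sub>0 r (\<lambda>z. G' (of_real s + of_real \<epsilon> * z))" using ch p by simp
      have "\<phi> ` \<Omega> \<subseteq> snd ` S" using assms(4) by (force simp: graph_over_def)
      then show "bounded (\<phi> ` \<Omega>)" using bounded_snd[OF assms(5)] bounded_subset by blast
      show "G' (of_real s + of_real \<epsilon> * z) \<in> W" if "z \<in> ball 0 r" for z using inN[OF that] W by blast
      show "R (G' (of_real s + of_real \<epsilon> * z)) = G' (of_real s + of_real \<epsilon> * cnj z)" if "z \<in> ball 0 r" for z
        using W(2) inN[OF that] by simp
      show "G' (of_real s + of_real \<epsilon> * of_real x) \<in> \<gamma> ` I" if "\<bar>x\<bar> < r" for x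
      proof -
        have "G' (of_real (s + \<epsilon> * x)) \<in> \<Gamma>" using G' inI[OF that] reg'(2) by blast
        then show ?thesis using \<Gamma>(2) by simp
      qed
      show "(\<phi> \<longlongrightarrow> a) (at (\<gamma> x) within \<Omega>)" if "x \<in> I" "x < s\<^sub>0" for x using limit that by blast
      show "(\<phi> \<longlongrightarrow> b) (at (\<gamma> x) within \<Omega>)" if "x \<in> I" "s\<^sub>0 < x" for x using limit that by blast
    qed (fact assms(9,18))+
  qed
  ultimately show ?thesis unfolding extends_real_analytically_across_def by blast
qed

end
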